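(* Let $p,q,b$ be constants such that $1\le p<q$ and $b>1/2$. For $M_q>0$ let $\mathcal P_{\rm poly}(q,b,M_q)$ be the class of probability measures $\mu$ on $L_2=\{x\in\mathbb R^\infty:\sum_{m\ge1}x_m^2<\infty\}$ satisfying $$\mathbb E_{X\sim\mu}\left[\sum_{m=1}^\infty\left(m^bX_m\right)^2\right]^{q/2}\le M_q^q .$$ Then there exist positive constants $\underline c_{p,q,b}$ and $\bar c_{p,q,b}$ depending on $(p,q,b)$ such that, for all $M_q>0$ and all integers $n\ge 2$, $$\underline c_{p,q,b}\,M_q(\log n)^{-b}\le\sup_{\mu\in\mathcal P_{\rm poly}(q,b,M_q)}\mathbb E\,W_p(\hat\mu,\mu)\le\bar c_{p,q,b}\,M_q(\log n)^{-b},$$ where $\hat\mu$ is the empirical measure of $n$ independent samples from $\mu$.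
   Context: $L_2$ is the separable Hilbert space of square-summable sequences with norm $\|x\|=(\sum_m x_m^2)^{1/2}$; $X_m$ denotes the $m$-th coordinate of $X$. For probability measures $\mu,\nu$ on $L_2$ and $p\in[1,\infty)$, $W_p(\mu,\nu)=\inf_{\xi\in\mathcal C(\mu,\nu)}\left[\mathbb E_{(X,Y)\sim\xi}\|X-Y\|^p\right]^{1/p}$, where $\mathcal C(\mu,\nu)$ is the set of all distributions on $L_2\times L_2$ with marginals $\mu$ and $\nu$. The empirical measure $\hat\mu$ puts mass $1/n$ at each of $n$ independent samples from $\mu$; the expectation is over these samples. *)

theory Defs
  imports "HOL-Probability.Probability"
begin

section \<open>The Hilbert space of square-summable sequences\<close>

text \<open>Coordinates are indexed from 0 here, so \<open>coord x m\<close> is the mathematical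
  coordinate with number \<open>m + 1\<close>.\<close>

typedef l2 = "{x :: nat \<Rightarrow> real. summable (\<lambda>m. (x m)\<^sup>2)}"
  morphisms coord Abs_l2
  by (rule exI[of _ "\<lambda>_. 0"]) simp

setup_lifting type_definition_l2

lemma l2_eqI: "(\<And>m. coord x m = coord y m) \<Longrightarrow> x = y"
  by (metis coord_inject ext)

lemma summable_coord_sq: "summable (\<lambda>m. (coord x m)\<^sup>2)"
  using coord[of x] by simp

lemma summable_prod_of_sq:
  fixes f g :: "nat \<Rightarrow> real"
  assumes "summable (\<lambda>m. (f m)\<^sup>2)" "summable (\<lambda>m. (g m)\<^sup>2)"
  shows "summable (\<lambda>m. f m * g m)"
proof (rule summable_comparison_test)
  show "summable (\<lambda>m. (f m)\<^sup>2 + (g m)\<^sup>2)"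
    using assms by (rule summable_add)
  have "\<bar>a * b\<bar> \<le> a\<^sup>2 + b\<^sup>2" for a b :: real
  proof -
    have "0 \<le> (\<bar>a\<bar> - \<bar>b\<bar>)\<^sup>2" by simp
    then have "2 * (\<bar>a\<bar> * \<bar>b\<bar>) \<le> a\<^sup>2 + b\<^sup>2" by (simp add: power2_diff)
    moreover have "0 \<le> \<bar>a\<bar> * \<bar>b\<bar>" by simp
    ultimately show ?thesis unfolding abs_mult by linarith
  qed
  then show "\<exists>N. \<forall>m\<ge>N. norm (f m * g m) \<le> (f m)\<^sup>2 + (g m)\<^sup>2"
    by auto
qed

lemma summable_coord_prod: "summable (\<lambda>m. coord x m * coord y m)"
  by (intro summable_prod_of_sq summable_coord_sq)

lemma summable_add_sq:
  fixes f g :: "nat \<Rightarrow> real"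
  assumes "summable (\<lambda>m. (f m)\<^sup>2)" "summable (\<lambda>m. (g m)\<^sup>2)"
  shows "summable (\<lambda>m. (f m + g m)\<^sup>2)"
proof -
  have "summable (\<lambda>m. (f m)\<^sup>2 + (g m)\<^sup>2 + 2 * (f m * g m))"
    using assms by (intro summable_add summable_mult summable_prod_of_sq)
  then show ?thesis by (simp add: power2_sum algebra_simps)
qed

instantiation l2 :: real_vector
begin

lift_definition zero_l2 :: l2 is "\<lambda>_. 0" by simp
lift_definition plus_l2 :: "l2 \<Rightarrow> l2 \<Rightarrow> l2" is "\<lambda>x y m. x m + y m"
  by (rule summable_add_sq)
lift_definition uminus_l2 :: "l2 \<Rightarrow> l2" is "\<lambda>x m. - x m" by simp
lift_definition minus_l2 :: "l2 \<Rightarrow> l2 \<Rightarrow> l2" is "\<lambda>x y m. x m - y m"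
  subgoal for x y using summable_add_sq[of x "\<lambda>m. - y m"] by simp
  done
lift_definition scaleR_l2 :: "real \<Rightarrow> l2 \<Rightarrow> l2" is "\<lambda>r x m. r * x m"
  by (simp add: power_mult_distrib summable_mult)

instance
  by standard (transfer; simp add: algebra_simps)+

end

lemmas coord_simps [simp] =
  zero_l2.rep_eq plus_l2.rep_eq uminus_l2.rep_eq minus_l2.rep_eq scaleR_l2.rep_eq

instantiation l2 :: real_inner
begin

definition inner_l2 :: "l2 \<Rightarrow> l2 \<Rightarrow> real"
  where "inner_l2 x y = (\<Sum>m. coord x m * coord y m)"
definition norm_l2 :: "l2 \<Rightarrow> real"
  where "norm_l2 x = sqrt (\<Sum>m. (coord x m)\<^sup>2)"
definition dist_l2 :: "l2 \<Rightarrow> l2 \<Rightarrow> real"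
  where "dist_l2 x y = norm (x - y)"
definition sgn_l2 :: "l2 \<Rightarrow> l2"
  where "sgn_l2 x = inverse (norm x) *\<^sub>R x"
definition uniformity_l2 :: "(l2 \<times> l2) filter"
  where "uniformity_l2 = (INF e\<in>{0 <..}. principal {(x, y). dist x y < e})"
definition open_l2 :: "l2 set \<Rightarrow> bool"
  where "open_l2 U \<longleftrightarrow> (\<forall>x\<in>U. eventually (\<lambda>(x', y). x' = x \<longrightarrow> y \<in> U) uniformity)"

instance
proof
  fix x y z :: l2 and r :: real and U :: "l2 set"
  show "dist x y = norm (x - y)" by (rule dist_l2_def)
  show "sgn x = x /\<^sub>R norm x" by (rule sgn_l2_def)
  show "uniformity = (INF e\<in>{0 <..}. principal {(x :: l2, y). dist x y < e})"
    by (rule uniformity_l2_def)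
  show "open U \<longleftrightarrow> (\<forall>x\<in>U. eventually (\<lambda>(x', y). x' = x \<longrightarrow> y \<in> U) uniformity)"
    by (rule open_l2_def)
  show "inner x y = inner y x" by (simp add: inner_l2_def mult.commute)
  show "inner (x + y) z = inner x z + inner y z"
    by (simp add: inner_l2_def distrib_right suminf_add summable_coord_prod)
  show "inner (r *\<^sub>R x) y = r * inner x y"
    by (simp add: inner_l2_def mult.assoc suminf_mult summable_coord_prod)
  show "0 \<le> inner x x"
    by (simp add: inner_l2_def suminf_nonneg summable_coord_prod)
  show "inner x x = 0 \<longleftrightarrow> x = 0"
  proof
    assume "inner x x = 0"
    then have "\<forall>m. coord x m * coord x m = 0"
      using suminf_eq_zero_iff[OF summable_coord_prod[of x x]] by (simp add: inner_l2_def)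
    then show "x = 0" by (intro l2_eqI) simp
  qed (simp add: inner_l2_def)
  show "norm x = sqrt (inner x x)"
    by (simp add: norm_l2_def inner_l2_def power2_eq_square)
qed

end

lemma norm_l2_sq: "(norm x)\<^sup>2 = (\<Sum>m. (coord x m)\<^sup>2)" for x :: l2
  by (simp add: norm_l2_def suminf_nonneg summable_coord_sq)

lemma sum_coord_sq_le: "(\<Sum>m<K. (coord x m)\<^sup>2) \<le> (norm x)\<^sup>2" for x :: l2
  unfolding norm_l2_sq by (intro sum_le_suminf summable_coord_sq) auto

lemma abs_coord_le_norm: "\<bar>coord x m\<bar> \<le> norm x" for x :: l2
proof (rule power2_le_imp_le)
  have "(coord x m)\<^sup>2 \<le> (\<Sum>i<Suc m. (coord x i)\<^sup>2)"
    by (simp add: sum_nonneg)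
  also have "\<dots> \<le> (norm x)\<^sup>2" by (rule sum_coord_sq_le)
  finally show "\<bar>coord x m\<bar>\<^sup>2 \<le> (norm x)\<^sup>2" by simp
qed simp

instance l2 :: complete_space
proof
  fix X :: "nat \<Rightarrow> l2" assume X: "Cauchy X"
  have "Cauchy (\<lambda>n. coord (X n) m)" for m
  proof (rule CauchyI)
    fix e :: real assume "e > 0"
    then obtain M where M: "\<forall>n\<ge>M. \<forall>k\<ge>M. norm (X n - X k) < e"
      using CauchyD[OF X] by blast
    have "norm (coord (X n) m - coord (X k) m) < e" if "n \<ge> M" "k \<ge> M" for n k
      using abs_coord_le_norm[of "X n - X k" m] M that by fastforce
    then show "\<exists>M. \<forall>n\<ge>M. \<forall>k\<ge>M. norm (coord (X n) m - coord (X k) m) < e" by blast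
  qed
  then have "\<exists>l. (\<lambda>n. coord (X n) m) \<longlonglongrightarrow> l" for m
    by (simp add: Cauchy_convergent_iff convergent_def)
  then obtain y where y: "\<And>m. (\<lambda>n. coord (X n) m) \<longlonglongrightarrow> y m" by metis
  have part: "(\<Sum>m<K. (coord (X n) m - y m)\<^sup>2) \<le> e\<^sup>2"
    if e: "e > 0" and M: "\<forall>n\<ge>M. \<forall>k\<ge>M. norm (X n - X k) < e" and n: "n \<ge> M" for e M n K
  proof (rule tendsto_upperbound)
    show "(\<lambda>k. \<Sum>m<K. (coord (X n) m - coord (X k) m)\<^sup>2)
            \<longlonglongrightarrow> (\<Sum>m<K. (coord (X n) m - y m)\<^sup>2)"
      by (intro tendsto_intros y)
    have "(\<Sum>m<K. (coord (X n) m - coord (X k) m)\<^sup>2) \<le> e\<^sup>2" if "k \<ge> M" for k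
    proof -
      have "(\<Sum>m<K. (coord (X n) m - coord (X k) m)\<^sup>2) \<le> (norm (X n - X k))\<^sup>2"
        using sum_coord_sq_le[of "X n - X k" K] by simp
      also have "\<dots> \<le> e\<^sup>2" using M n that by (simp add: power_mono less_imp_le)
      finally show ?thesis .
    qed
    then show "\<forall>\<^sub>F k in sequentially. (\<Sum>m<K. (coord (X n) m - coord (X k) m)\<^sup>2) \<le> e\<^sup>2"
      by (auto simp: eventually_sequentially)
  qed simp
  have sm: "summable (\<lambda>m. (coord (X n) m - y m)\<^sup>2)"
    and bd: "(\<Sum>m. (coord (X n) m - y m)\<^sup>2) \<le> e\<^sup>2"
    if "e > 0" "\<forall>n\<ge>M. \<forall>k\<ge>M. norm (X n - X k) < e" "n \<ge> M" for e M n
  proof -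
    show *: "summable (\<lambda>m. (coord (X n) m - y m)\<^sup>2)"
      by (rule summableI_nonneg_bounded[OF _ part[OF that]]) simp
    show "(\<Sum>m. (coord (X n) m - y m)\<^sup>2) \<le> e\<^sup>2"
      by (rule suminf_le_const[OF * part[OF that]])
  qed
  obtain M where M: "\<forall>n\<ge>M. \<forall>k\<ge>M. norm (X n - X k) < 1"
    using CauchyD[OF X, of 1] by auto
  have "summable (\<lambda>m. (- (coord (X M) m - y m) + coord (X M) m)\<^sup>2)"
    using sm[OF _ M order_refl] summable_coord_sq[of "X M"]
    by (intro summable_add_sq) (simp_all add: power2_commute)
  then have "summable (\<lambda>m. (y m)\<^sup>2)" by simp
  then have co: "coord (Abs_l2 y) = y" by (simp add: Abs_l2_inverse)
  have "X \<longlonglongrightarrow> Abs_l2 y"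
  proof (rule LIMSEQ_I)
    fix r :: real assume r: "r > 0"
    then obtain M where M: "\<forall>n\<ge>M. \<forall>k\<ge>M. norm (X n - X k) < r / 2"
      using CauchyD[OF X, of "r / 2"] by auto
    have "norm (X n - Abs_l2 y) < r" if "n \<ge> M" for n
    proof -
      have "(norm (X n - Abs_l2 y))\<^sup>2 \<le> (r / 2)\<^sup>2"
        using bd[OF _ M that] r by (simp add: norm_l2_sq co)
      then have "norm (X n - Abs_l2 y) \<le> r / 2" by (rule power2_le_imp_le) (use r in simp)
      then show ?thesis using r by simp
    qed
    then show "\<exists>no. \<forall>n\<ge>no. norm (X n - Abs_l2 y) < r" by blast
  qed
  then show "convergent X" by (auto simp: convergent_def)
qed

definition l2_of_list :: "rat list \<Rightarrow> l2"
  where "l2_of_list xs = Abs_l2 (\<lambda>m. if m < length xs then of_rat (xs ! m) else 0)"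

lemma coord_l2_of_list:
  "coord (l2_of_list xs) m = (if m < length xs then of_rat (xs ! m) else 0)"
proof -
  have "summable (\<lambda>m. (if m < length xs then of_rat (xs ! m) else 0 :: real)\<^sup>2)"
    by (rule summable_finite[of "{..<length xs}"]) auto
  then show ?thesis by (simp add: l2_of_list_def Abs_l2_inverse)
qed

lemma l2_of_list_dense:
  assumes "e > 0" shows "\<exists>xs. dist (l2_of_list xs) x < e"
proof -
  define s where "s = (\<lambda>m. (coord x m)\<^sup>2)"
  have s: "summable s" unfolding s_def by (rule summable_coord_sq)
  obtain K where K: "norm (\<Sum>i. s (i + K)) < e\<^sup>2 / 2"
    using suminf_exist_split[OF _ s, of "e\<^sup>2 / 2"] assms by auto
  define d where "d = e / sqrt (2 * (real K + 1))"
  have d: "d > 0" and d2: "real K * d\<^sup>2 < e\<^sup>2 / 2"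
    using assms by (auto simp: d_def power_divide field_simps)
  have "\<exists>r. \<bar>of_rat r - coord x m\<bar> < d" for m
  proof -
    obtain r where "coord x m - d < of_rat r" "of_rat r < coord x m + d"
      using of_rat_dense[of "coord x m - d" "coord x m + d"] d by auto
    then show ?thesis by (intro exI[of _ r]) (simp add: abs_less_iff)
  qed
  then obtain r where r: "\<And>m. \<bar>of_rat (r m) - coord x m\<bar> < d" by metis
  define z where "z = l2_of_list (map r [0..<K])"
  define t where "t = (\<lambda>m. (coord (z - x) m)\<^sup>2)"
  have t: "summable t" unfolding t_def by (rule summable_coord_sq)
  have "(norm (z - x))\<^sup>2 = (\<Sum>i. t (i + K)) + (\<Sum>i<K. t i)"
    unfolding norm_l2_sq using suminf_split_initial_segment[OF t, of K] by (simp add: t_def)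
  also have "(\<lambda>i. t (i + K)) = (\<lambda>i. s (i + K))"
    by (simp add: t_def s_def z_def coord_l2_of_list)
  also have "(\<Sum>i<K. t i) \<le> (\<Sum>i<K. d\<^sup>2)"
  proof (rule sum_mono)
    fix i assume "i \<in> {..<K}"
    then have "t i = \<bar>of_rat (r i) - coord x i\<bar>\<^sup>2"
      by (simp add: t_def z_def coord_l2_of_list)
    also have "\<dots> \<le> d\<^sup>2" by (rule power_mono) (use r[of i] in simp_all)
    finally show "t i \<le> d\<^sup>2" .
  qed
  finally have "(norm (z - x))\<^sup>2 < e\<^sup>2" using K d2 by simp
  then have "norm (z - x) < e" by (rule power2_less_imp_less) (use assms in simp)
  then show ?thesis unfolding dist_norm z_def by blast
qed

instance l2 :: second_countable_topology
proof
  define B where "B = (\<lambda>(xs, r). ball (l2_of_list xs) (of_rat r)) ` (UNIV :: (rat list \<times> rat) set)"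
  have "topological_basis B"
  proof (rule topological_basisI)
    show "open b" if "b \<in> B" for b using that by (auto simp: B_def)
  next
    fix U :: "l2 set" and x assume "open U" "x \<in> U"
    then obtain e where e: "e > 0" "ball x e \<subseteq> U" by (meson open_contains_ball)
    obtain r where r: "0 < (of_rat r :: real)" "of_rat r < e / 2"
      using of_rat_dense[of 0 "e / 2"] e(1) by auto
    obtain xs where xs: "dist (l2_of_list xs) x < of_rat r"
      using l2_of_list_dense[OF r(1)] by blast
    have "ball (l2_of_list xs) (of_rat r) \<subseteq> ball x e"
    proof
      fix w assume "w \<in> ball (l2_of_list xs) (of_rat r)"
      then show "w \<in> ball x e"
        using xs r dist_triangle[of x w "l2_of_list xs"] by (simp add: dist_commute)
    qed
    then show "\<exists>b\<in>B. x \<in> b \<and> b \<subseteq> U"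
      using xs e(2) by (intro bexI[of _ "ball (l2_of_list xs) (of_rat r)"]) (auto simp: B_def)
  qed
  moreover have "countable B" unfolding B_def by (intro countable_image) auto
  ultimately show "\<exists>B :: l2 set set. countable B \<and> open = generate_topology B"
    using topological_basis_imp_subbasis by blast
qed

instance l2 :: polish_space ..


section \<open>Wasserstein distance and empirical measures\<close>

text \<open>Real powers of extended nonnegative numbers; only used with exponent \<open>a > 0\<close>.\<close>

definition ennreal_powr :: "ennreal \<Rightarrow> real \<Rightarrow> ennreal"
  where "ennreal_powr x a = (if x = \<infinity> then \<infinity> else ennreal (enn2real x powr a))"

text \<open>Borel probability measures on \<^typ>\<open>l2\<close>.\<close>

definition l2_prob :: "l2 measure set"
  where "l2_prob = {\<mu>. prob_space \<mu> \<and> sets \<mu> = sets borel}"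

text \<open>As \<^typ>\<open>l2\<close> is second countable, the product sigma-algebra below is the Borel
  sigma-algebra of the product space.\<close>

definition couplings :: "l2 measure \<Rightarrow> l2 measure \<Rightarrow> (l2 \<times> l2) measure set"
  where "couplings \<mu> \<nu> =
    {\<xi>. prob_space \<xi> \<and> sets \<xi> = sets (borel \<Otimes>\<^sub>M borel) \<and>
        distr \<xi> borel fst = \<mu> \<and> distr \<xi> borel snd = \<nu>}"

definition wasserstein :: "real \<Rightarrow> l2 measure \<Rightarrow> l2 measure \<Rightarrow> ennreal"
  where "wasserstein p \<mu> \<nu> =
    (INF \<xi>\<in>couplings \<mu> \<nu>.
       ennreal_powr (\<integral>\<^sup>+ (x, y). ennreal (norm (x - y) powr p) \<partial>\<xi>) (1 / p))"

definition empirical :: "nat \<Rightarrow> (nat \<Rightarrow> l2) \<Rightarrow> l2 measure"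
  where "empirical n X = distr (uniform_count_measure {..<n}) borel X"

text \<open>The \<open>n\<close> independent samples are the coordinates of the \<open>n\<close>-fold product measure.\<close>

definition expected_wasserstein :: "real \<Rightarrow> nat \<Rightarrow> l2 measure \<Rightarrow> ennreal"
  where "expected_wasserstein p n \<mu> =
    (\<integral>\<^sup>+ X. wasserstein p (empirical n X) \<mu> \<partial>(\<Pi>\<^sub>M i\<in>{..<n}. \<mu>))"

text \<open>The weight of the 0-based coordinate \<open>m\<close> is \<open>(m + 1) powr b\<close>; the weighted sum may be
  infinite.\<close>

definition P_poly :: "real \<Rightarrow> real \<Rightarrow> real \<Rightarrow> l2 measure set"
  where "P_poly q b M =
    {\<mu> \<in> l2_prob.
      (\<integral>\<^sup>+ x. ennreal_powr (\<Sum>m. ennreal ((real (Suc m) powr b * coord x m)\<^sup>2)) (q / 2) \<partial>\<mu>)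
        \<le> ennreal (M powr q)}"

end

theory Submission
  imports Defs
begin

text \<open>
  Lower bound: let \<open>\<mu>\<close> be uniform on the vertices of a \<open>K\<close>-dimensional cube of side
  \<open>2 M K\<^bsup>-b-1/2\<^esup>\<close>. A ball of radius \<open>c M K\<^bsup>-b\<^esup>\<close> around any point of the Hilbert space contains
  at most a fraction \<open>exp (- K / 8)\<close> of the vertices, so for \<open>K \<approx> log n\<close> half of the mass of \<open>\<mu>\<close> is at
  distance at least \<open>c M K\<^bsup>-b\<^esup>\<close> from any \<open>n\<close> points, whatever the sample.

  Upper bound: write \<open>|x|\<^sub>b\<close> for the norm with weights \<open>m\<^bsup>b\<^esup>\<close>. The ellipsoid \<open>|x|\<^sub>b \<le> M j\<close> splits
  into \<open>exp (O (K))\<close> cells on which \<open>x\<close> is determined up to an error \<open>O (M j K\<^bsup>-b\<^esup>)\<close>. With \<open>K = \<epsilon> log n\<close>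
  and \<open>j\<close> up to a power of \<open>log n\<close>, the total number of cells is a small power of \<open>n\<close>, hence the
  cell frequencies of the empirical measure are polynomially close in total variation to those
  of \<open>\<mu>\<close>. Coupling the two measures optimally on the level of cells, only the quantization error
  contributes to the rate; the mass outside the outermost ellipsoid is controlled by the moment of
  order \<open>q > p\<close>.
\<close>

section \<open>The lower bound\<close>

lemma ennreal_powr_ennreal: "0 \<le> r \<Longrightarrow> ennreal_powr (ennreal r) a = ennreal (r powr a)"
  by (simp add: ennreal_powr_def)

lemma ennreal_powr_mono:
  assumes "x \<le> y" "0 \<le> a" shows "ennreal_powr x a \<le> ennreal_powr y a"
proof (cases y)
  case (real r)
  with assms obtain s where "x = ennreal s" "0 \<le> s" "s \<le> r"
    by (cases x) (auto simp: top_unique)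
  with real assms show ?thesis by (simp add: ennreal_powr_ennreal powr_mono2)
qed (simp add: ennreal_powr_def)

lemma measurable_coord [measurable]: "(\<lambda>x. coord x m) \<in> borel_measurable borel"
proof (rule borel_measurable_continuous_onI)
  show "continuous_on UNIV (\<lambda>x. coord x m)"
    unfolding continuous_on_iff
  proof (intro ballI allI impI)
    fix x :: l2 and e :: real assume "0 < e"
    have "dist (coord y m) (coord x m) \<le> dist y x" for y
      using abs_coord_le_norm[of "y - x" m] by (simp add: dist_norm)
    then show "\<exists>d>0. \<forall>y\<in>UNIV. dist y x < d \<longrightarrow> dist (coord y m) (coord x m) < e"
      using \<open>0 < e\<close> by (intro exI[of _ e]) (auto intro: le_less_trans)
  qed
qed

text \<open>Under any coupling the first point lies in \<open>F\<close> almost surely, so with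
  probability at least \<open>c\<close> the two points are at least \<open>\<rho>\<close> apart,
  which costs at least \<open>\<rho> powr p * c\<close>.\<close>

lemma wasserstein_ge:
  assumes p: "1 \<le> p" and \<rho>: "0 \<le> \<rho>" and c: "0 \<le> c"
    and F: "finite F" and \<nu>F: "emeasure \<nu> (- F) = 0"
    and \<mu>U: "ennreal c \<le> emeasure \<mu> {y. \<forall>x\<in>F. \<rho> \<le> norm (x - y)}"
  shows "ennreal (\<rho> * c powr (1 / p)) \<le> wasserstein p \<nu> \<mu>"
  unfolding wasserstein_def
proof (rule INF_greatest)
  fix \<xi> assume "\<xi> \<in> couplings \<nu> \<mu>"
  then interpret \<xi>: prob_space \<xi> by (simp add: couplings_def)
  have sets_\<xi> [measurable_cong]: "sets \<xi> = sets (borel \<Otimes>\<^sub>M borel)"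
    and \<nu>: "\<nu> = distr \<xi> borel fst" and \<mu>: "\<mu> = distr \<xi> borel snd"
    using \<open>\<xi> \<in> couplings \<nu> \<mu>\<close> by (auto simp: couplings_def)
  have sp: "space \<xi> = UNIV" using sets_eq_imp_space_eq[OF sets_\<xi>] by (simp add: space_pair_measure)
  define U where "U = {y. \<forall>x\<in>F. \<rho> \<le> norm (x - y)}"
  have U: "U \<in> sets borel"
    unfolding U_def using F by (simp add: countable_finite)
  have F': "F \<in> sets borel" using F by (simp add: finite_imp_closed borel_closed)
  have "ennreal c \<le> emeasure \<xi> (UNIV \<times> U)"
  proof -
    have "emeasure \<mu> U = emeasure \<xi> (snd -` U \<inter> space \<xi>)"
      unfolding \<mu> using U by (intro emeasure_distr) auto
    also have "snd -` U \<inter> space \<xi> = UNIV \<times> U" using sp by auto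
    finally show ?thesis using \<mu>U by (simp add: U_def)
  qed
  also have "\<dots> \<le> emeasure \<xi> (F \<times> U) + emeasure \<xi> ((- F) \<times> UNIV)"
    using U F' by (intro order.trans[OF emeasure_mono emeasure_subadditive]) (auto simp: sets_\<xi>)
  also have "emeasure \<xi> ((- F) \<times> UNIV) = 0"
  proof -
    have "emeasure \<nu> (- F) = emeasure \<xi> (fst -` (- F) \<inter> space \<xi>)"
      unfolding \<nu> using F' by (intro emeasure_distr) auto
    also have "fst -` (- F) \<inter> space \<xi> = (- F) \<times> UNIV" using sp by auto
    finally show ?thesis using \<nu>F by simp
  qed
  finally have c': "ennreal c \<le> emeasure \<xi> (F \<times> U)" by simp
  have "ennreal (\<rho> powr p * c) = ennreal (\<rho> powr p) * ennreal c"
    by (simp add: ennreal_mult' c)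
  also have "\<dots> \<le> ennreal (\<rho> powr p) * emeasure \<xi> (F \<times> U)"
    by (intro mult_left_mono c') simp
  also have "\<dots> = (\<integral>\<^sup>+z. ennreal (\<rho> powr p) * indicator (F \<times> U) z \<partial>\<xi>)"
    using U F' by (subst nn_integral_cmult_indicator) (auto simp: sets_\<xi>)
  also have "\<dots> \<le> (\<integral>\<^sup>+ (x, y). ennreal (norm (x - y) powr p) \<partial>\<xi>)"
    using p \<rho> by (intro nn_integral_mono) 
      (auto simp: U_def indicator_def intro!: ennreal_leI powr_mono2)
  finally have "ennreal_powr (ennreal (\<rho> powr p * c)) (1 / p) \<le>
      ennreal_powr (\<integral>\<^sup>+ (x, y). ennreal (norm (x - y) powr p) \<partial>\<xi>) (1 / p)"
    using p by (intro ennreal_powr_mono) auto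
  then show "ennreal (\<rho> * c powr (1 / p)) \<le>
      ennreal_powr (\<integral>\<^sup>+ (x, y). ennreal (norm (x - y) powr p) \<partial>\<xi>) (1 / p)"
    using p \<rho> c by (simp add: ennreal_powr_ennreal powr_mult powr_powr)
qed

section \<open>Counting cube vertices in a ball\<close>

definition l2_of_fun :: "nat \<Rightarrow> (nat \<Rightarrow> real) \<Rightarrow> l2"
  where "l2_of_fun K f = Abs_l2 (\<lambda>m. if m < K then f m else 0)"

lemma coord_l2_of_fun [simp]: "coord (l2_of_fun K f) m = (if m < K then f m else 0)"
proof -
  have "summable (\<lambda>m. (if m < K then f m else 0)\<^sup>2)"
    by (rule summable_finite[of "{..<K}"]) auto
  then show ?thesis by (simp add: l2_of_fun_def Abs_l2_inverse)
qed

abbreviation sign_cube :: "nat \<Rightarrow> (nat \<Rightarrow> real) set"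
  where "sign_cube K \<equiv> {..<K} \<rightarrow>\<^sub>E {-1, 1}"

text \<open>One coordinate of the Chernoff bound below. One of the two signs has distance at least 1
  from \<open>u\<close>, so its term is at most \<open>exp (- 1)\<close>. The sum stays below 2
  uniformly in \<open>u\<close>, an exponential gain over the \<open>2 ^ K\<close> vertices.\<close>

lemma exp_sq_dist_signs_le: "exp (- (u - 1)\<^sup>2) + exp (- (u + 1)\<^sup>2) \<le> 1 + exp (- 1)" for u :: real
proof -
  have *: "exp (- (u - 1)\<^sup>2) + exp (- (u + 1)\<^sup>2) \<le> 1 + exp (- 1)" if "0 \<le> u" for u :: real
  proof (rule add_mono)
    have "1 \<le> (u + 1)\<^sup>2" using that by (simp add: one_le_power)
    then show "exp (- (u + 1)\<^sup>2) \<le> exp (- 1)" by simp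
  qed simp
  show ?thesis
  proof (cases "0 \<le> u")
    case False
    then show ?thesis using *[of "- u"] by (simp add: power2_eq_square algebra_simps)
  qed (use * in simp)
qed

text \<open>Chernoff bound: the exponential of \<open>\<rho>^2 / a^2 - ?d s\<close> is at least 1 on
  the ball, and its sum over all sign vectors factorizes over the coordinates. The centre is
  arbitrary, as it will be a sample value.\<close>

lemma card_sign_cube_ball_le:
  assumes "0 < a" "0 \<le> \<rho>"
  shows "real (card {s \<in> sign_cube K. norm (x - l2_of_fun K (\<lambda>m. a * s m)) < \<rho>})
    \<le> exp (\<rho>\<^sup>2 / a\<^sup>2) * (1 + exp (- 1)) ^ K"
proof -
  let ?B = "{s \<in> sign_cube K. norm (x - l2_of_fun K (\<lambda>m. a * s m)) < \<rho>}"
  let ?d = "\<lambda>s. \<Sum>m<K. (coord x m / a - s m)\<^sup>2"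
  have fin: "finite (sign_cube K)" by (intro finite_PiE) auto
  have "real (card ?B) = (\<Sum>s\<in>?B. 1)" by simp
  also have "\<dots> \<le> (\<Sum>s\<in>?B. exp (\<rho>\<^sup>2 / a\<^sup>2 - ?d s))"
  proof (rule sum_mono)
    fix s assume "s \<in> ?B"
    then have "norm (x - l2_of_fun K (\<lambda>m. a * s m)) \<le> \<rho>" by simp
    then have "(norm (x - l2_of_fun K (\<lambda>m. a * s m)))\<^sup>2 \<le> \<rho>\<^sup>2" by (simp add: power_mono)
    \<comment> \<open>Coordinates from \<open>K\<close> on only enlarge the norm.\<close>
    then have "(\<Sum>m<K. (coord x m - a * s m)\<^sup>2) \<le> \<rho>\<^sup>2"
      using sum_coord_sq_le[of "x - l2_of_fun K (\<lambda>m. a * s m)" K] by simp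
    moreover have "(\<Sum>m<K. (coord x m - a * s m)\<^sup>2) = a\<^sup>2 * ?d s"
      unfolding sum_distrib_left using \<open>0 < a\<close>
      by (intro sum.cong) (simp_all add: power_mult_distrib[symmetric] right_diff_distrib)
    ultimately have "?d s \<le> \<rho>\<^sup>2 / a\<^sup>2"
      using \<open>0 < a\<close> by (simp add: field_simps)
    then show "1 \<le> exp (\<rho>\<^sup>2 / a\<^sup>2 - ?d s)" by simp
  qed
  also have "\<dots> \<le> (\<Sum>s\<in>sign_cube K. exp (\<rho>\<^sup>2 / a\<^sup>2 - ?d s))"
    using fin by (intro sum_mono2) auto
  also have "\<dots> = exp (\<rho>\<^sup>2 / a\<^sup>2) * (\<Sum>s\<in>sign_cube K. \<Prod>m<K. exp (- (coord x m / a - s m)\<^sup>2))"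
    unfolding sum_distrib_left
    by (intro sum.cong) (simp_all add: exp_sum[symmetric] sum_negf exp_add[symmetric])
  also have "(\<Sum>s\<in>sign_cube K. \<Prod>m<K. exp (- (coord x m / a - s m)\<^sup>2)) =
      (\<Prod>m<K. \<Sum>t\<in>{-1, 1}. exp (- (coord x m / a - t)\<^sup>2))"
    by (subst prod_sum_PiE) auto
  also have "\<dots> \<le> (\<Prod>m<K. 1 + exp (- 1))"
  proof (rule prod_mono, intro conjI)
    fix m
    show "(\<Sum>t\<in>{-1, 1}. exp (- (coord x m / a - t)\<^sup>2)) \<le> 1 + exp (- 1 :: real)"
      using exp_sq_dist_signs_le[of "coord x m / a"] by simp
  qed (auto intro: sum_nonneg)
  finally show ?thesis by simp
qed

text \<open>Compares the Chernoff factor with the number 2 of signs: if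
  \<open>\<rho>^2 / a^2 = K / 8\<close>, the fraction of vertices in a ball is at most
  \<open>exp (K / 8 - K / 4) = exp (- K / 8)\<close>.\<close>

lemma one_plus_exp_minus_1_le: "1 + exp (- 1) \<le> 2 * exp (- (1 / 4) :: real)"
proof -
  have "(2 :: real) \<le> exp 1" using exp_ge_add_one_self[of "1 :: real"] by simp
  then have "exp (- 1) \<le> (1 / 2 :: real)" by (simp add: exp_minus field_simps)
  moreover have "3 / 4 \<le> exp (- (1 / 4) :: real)"
    using exp_ge_add_one_self[of "- (1 / 4) :: real"] by simp
  ultimately show ?thesis by linarith
qed

section \<open>The uniform measure on the cube and its samples\<close>

lemma expected_wasserstein_ge:
  assumes \<mu>: "\<mu> \<in> l2_prob"
    and le: "\<And>X. X \<in> space (\<Pi>\<^sub>M i\<in>{..<n}. \<mu>) \<Longrightarrow> c \<le> wasserstein p (empirical n X) \<mu>"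
  shows "c \<le> expected_wasserstein p n \<mu>"
proof -
  interpret \<mu>: prob_space \<mu> using \<mu> by (simp add: l2_prob_def)
  interpret P: prob_space "\<Pi>\<^sub>M i\<in>{..<n}. \<mu>" by (intro prob_space_PiM) unfold_locales
  have "c = (\<integral>\<^sup>+ X. c \<partial>(\<Pi>\<^sub>M i\<in>{..<n}. \<mu>))"
    by (simp add: P.emeasure_space_1)
  also have "\<dots> \<le> expected_wasserstein p n \<mu>"
    unfolding expected_wasserstein_def by (intro nn_integral_mono le)
  finally show ?thesis .
qed

lemma emeasure_empirical:
  assumes "A \<in> sets borel"
  shows "emeasure (empirical n X) A = ennreal (real (card {i\<in>{..<n}. X i \<in> A}) / real n)"
proof -
  have "emeasure (empirical n X) A = emeasure (uniform_count_measure {..<n}) (X -` A \<inter> {..<n})"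
    unfolding empirical_def using assms
    by (subst emeasure_distr) (auto simp: measurable_def space_uniform_count_measure sets_uniform_count_measure)
  also have "X -` A \<inter> {..<n} = {i\<in>{..<n}. X i \<in> A}" by auto
  finally show ?thesis by (subst (asm) emeasure_uniform_count_measure) auto
qed

definition cube_measure :: "real \<Rightarrow> nat \<Rightarrow> l2 measure"
  where "cube_measure a K = distr (uniform_count_measure (sign_cube K)) borel (\<lambda>s. l2_of_fun K (\<lambda>m. a * s m))"

lemma finite_sign_cube [simp]: "finite (sign_cube K)"
  by (intro finite_PiE) auto

lemma card_sign_cube [simp]: "card (sign_cube K) = 2 ^ K"
  by (simp add: card_PiE numeral_2_eq_2)

lemma sign_cube_nonempty [simp]: "sign_cube K \<noteq> {}"
  using card_sign_cube[of K] by (metis card.empty power_not_zero zero_neq_numeral)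

lemma cube_measure_l2_prob: "cube_measure a K \<in> l2_prob"
  unfolding l2_prob_def cube_measure_def
  by (auto intro!: prob_space.prob_space_distr prob_space_uniform_count_measure
      simp: measurable_def space_uniform_count_measure sets_uniform_count_measure simp del: PiE_eq_empty_iff)

lemma emeasure_cube_measure:
  assumes "A \<in> sets borel"
  shows "emeasure (cube_measure a K) A =
    ennreal (real (card {s \<in> sign_cube K. l2_of_fun K (\<lambda>m. a * s m) \<in> A}) / 2 ^ K)"
proof -
  have "emeasure (cube_measure a K) A = emeasure (uniform_count_measure (sign_cube K))
      ((\<lambda>s. l2_of_fun K (\<lambda>m. a * s m)) -` A \<inter> sign_cube K)"
    unfolding cube_measure_def using assms
    by (subst emeasure_distr) (auto simp: measurable_def space_uniform_count_measure sets_uniform_count_measure)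
  also have "(\<lambda>s. l2_of_fun K (\<lambda>m. a * s m)) -` A \<inter> sign_cube K = {s \<in> sign_cube K. l2_of_fun K (\<lambda>m. a * s m) \<in> A}"
    by auto
  finally show ?thesis by (simp add: emeasure_uniform_count_measure)
qed

text \<open>Every single vertex has weighted norm at most \<open>M\<close>: each of its
  \<open>K\<close> coordinates contributes at most
  \<open>(K powr b * a)^2 = M^2 / K\<close>.\<close>

lemma cube_measure_P_poly:
  assumes M: "0 < M" and K: "0 < K" and b: "0 < b" and q: "0 < q" and a: "a = M * real K powr (- b - 1 / 2)"
  shows "cube_measure a K \<in> P_poly q b M"
proof -
  let ?\<mu> = "cube_measure a K"
  interpret \<mu>: prob_space ?\<mu> using cube_measure_l2_prob by (simp add: l2_prob_def)
  let ?w = "\<lambda>x. \<Sum>m. ennreal ((real (Suc m) powr b * coord x m)\<^sup>2)"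
  have w: "?w (l2_of_fun K (\<lambda>m. a * s m)) \<le> ennreal (M\<^sup>2)" if s: "s \<in> sign_cube K" for s
  proof -
    have "?w (l2_of_fun K (\<lambda>m. a * s m)) = (\<Sum>m<K. ennreal ((real (Suc m) powr b * (a * s m))\<^sup>2))"
      by (subst suminf_finite[of "{..<K}"]) auto
    also have "\<dots> \<le> (\<Sum>m<K. ennreal (M\<^sup>2 / real K))"
    proof (intro sum_mono ennreal_leI)
      fix m assume m: "m \<in> {..<K}"
      then have "s m = -1 \<or> s m = 1" using s by (auto simp: PiE_iff)
      then have "(real (Suc m) powr b * (a * s m))\<^sup>2 = (real (Suc m) powr b * a)\<^sup>2"
        by (auto simp: power_mult_distrib)
      also have "\<dots> \<le> (real K powr b * a)\<^sup>2"
        using m b a M by (intro power_mono mult_right_mono powr_mono2) auto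
      also have "real K powr b * a = M * real K powr (- 1 / 2)"
        unfolding a using K by (simp add: powr_add[symmetric])
      also have "\<dots>\<^sup>2 = M\<^sup>2 / real K"
        using K by (simp add: power_mult_distrib powr_minus_divide powr_half_sqrt power_divide)
      finally show "(real (Suc m) powr b * (a * s m))\<^sup>2 \<le> M\<^sup>2 / real K" .
    qed
    also have "\<dots> = ennreal (M\<^sup>2)" using K by (simp add: ennreal_of_nat_eq_real_of_nat ennreal_mult'[symmetric])
    finally show ?thesis .
  qed
  have "AE x in ?\<mu>. ?w x \<le> ennreal (M\<^sup>2)"
    unfolding cube_measure_def using w
    by (subst AE_distr_iff) (auto intro!: AE_I2 simp: measurable_def space_uniform_count_measure sets_uniform_count_measure)
  then have "(\<integral>\<^sup>+ x. ennreal_powr (?w x) (q / 2) \<partial>?\<mu>) \<le> (\<integral>\<^sup>+ x. ennreal_powr (ennreal (M\<^sup>2)) (q / 2) \<partial>?\<mu>)"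
    using q by (intro nn_integral_mono_AE) (auto elim!: eventually_mono intro: ennreal_powr_mono)
  also have "\<dots> = ennreal (M powr q)"
    using M by (simp add: \<mu>.emeasure_space_1 ennreal_powr_ennreal powr_numeral[symmetric] powr_powr del: powr_numeral)
  finally show ?thesis using cube_measure_l2_prob by (simp add: P_poly_def)
qed

text \<open>The ball of radius \<open>\<rho>\<close> around a sample value holds a fraction of at
  most \<open>exp (- K / 8) \<le> 1 / (2 * n)\<close> of the vertices, so half of the mass keeps
  distance \<open>\<rho>\<close> from the whole sample.\<close>

lemma wasserstein_empirical_cube_ge:
  assumes p: "1 \<le> p" and n: "0 < n" and K: "8 * ln (2 * real n) \<le> real K" and a: "0 < a"
  shows "ennreal (a * sqrt (real K / 8) / 2) \<le> wasserstein p (empirical n X) (cube_measure a K)"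
proof -
  \<comment> \<open>Makes \<open>\<rho>^2 / a^2\<close> equal to \<open>K / 8\<close>, half of the
    gain \<open>K / 4\<close> in the vertex count.\<close>
  define \<rho> where "\<rho> = a * sqrt (real K / 8)"
  have \<rho>: "0 \<le> \<rho>" "\<rho>\<^sup>2 / a\<^sup>2 = real K / 8" using a by (auto simp: \<rho>_def power_mult_distrib)
  let ?v = "\<lambda>s. l2_of_fun K (\<lambda>m. a * s m)"
  define F where "F = X ` {..<n}"
  have F: "finite F" "card F \<le> n" by (auto simp: F_def card_image_le[of "{..<n}", simplified])
  define U where "U = {y. \<forall>x\<in>F. \<rho> \<le> norm (x - y)}"
  have U: "U \<in> sets borel" unfolding U_def using F by (simp add: countable_finite)
  have "{s \<in> sign_cube K. ?v s \<notin> U} = (\<Union>x\<in>F. {s \<in> sign_cube K. norm (x - ?v s) < \<rho>})"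
    by (auto simp: U_def not_le)
  then have "real (card {s \<in> sign_cube K. ?v s \<notin> U}) \<le> (\<Sum>x\<in>F. real (card {s \<in> sign_cube K. norm (x - ?v s) < \<rho>}))"
    using card_UN_le[OF F(1), of "\<lambda>x. {s \<in> sign_cube K. norm (x - ?v s) < \<rho>}"]
    by (simp del: of_nat_sum add: of_nat_sum[symmetric])
  also have "\<dots> \<le> (\<Sum>x\<in>F. exp (real K / 8) * (1 + exp (- 1)) ^ K)"
    using card_sign_cube_ball_le[OF a \<rho>(1)] unfolding \<rho>(2) by (intro sum_mono)
  also have "\<dots> \<le> real n * (exp (real K / 8) * (2 * exp (- (1 / 4))) ^ K)"
    using F(2) one_plus_exp_minus_1_le 
    by (simp only: sum_constant, intro mult_mono power_mono) (auto intro: add_nonneg_nonneg)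
  also have "\<dots> = 2 ^ K * (real n * exp (- (real K / 8)))"
    by (simp add: power_mult_distrib exp_of_nat_mult[symmetric] exp_add[symmetric] exp_minus_inverse field_simps)
  also have "\<dots> \<le> 2 ^ K * (1 / 2)"
  proof (rule mult_left_mono)
    have "exp (- (real K / 8)) \<le> exp (- ln (2 * real n))" using K by (subst exp_le_cancel_iff) linarith
    also have "\<dots> = inverse (2 * real n)" using n by (subst exp_minus) simp
    finally show "real n * exp (- (real K / 8)) \<le> 1 / 2" using n by (simp add: field_simps)
  qed simp
  finally have "real (card {s \<in> sign_cube K. ?v s \<notin> U}) \<le> 2 ^ K / 2" by simp
  moreover have "card {s \<in> sign_cube K. ?v s \<in> U} + card {s \<in> sign_cube K. ?v s \<notin> U} = 2 ^ K"
  proof -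
    have un: "{s \<in> sign_cube K. ?v s \<in> U} \<union> {s \<in> sign_cube K. ?v s \<notin> U} = sign_cube K" by blast
    have "card ({s \<in> sign_cube K. ?v s \<in> U} \<union> {s \<in> sign_cube K. ?v s \<notin> U}) =
        card {s \<in> sign_cube K. ?v s \<in> U} + card {s \<in> sign_cube K. ?v s \<notin> U}"
    proof (rule card_Un_disjoint)
      show "finite {s \<in> sign_cube K. ?v s \<in> U}" "finite {s \<in> sign_cube K. ?v s \<notin> U}"
        using finite_sign_cube by (rule finite_subset[rotated], blast)+
    qed blast
    then show ?thesis by (simp only: un card_sign_cube)
  qed
  then have "real (card {s \<in> sign_cube K. ?v s \<in> U}) + real (card {s \<in> sign_cube K. ?v s \<notin> U}) = 2 ^ K"
    by (simp only: of_nat_add[symmetric] of_nat_power of_nat_numeral)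
  ultimately have "ennreal (1 / 2) \<le> emeasure (cube_measure a K) U"
    unfolding emeasure_cube_measure[OF U] by (intro ennreal_leI) (simp add: field_simps)
  moreover have "emeasure (empirical n X) (- F) = 0"
    using F(1) by (subst emeasure_empirical) (auto simp: F_def finite_imp_closed borel_closed)
  ultimately have *: "ennreal (\<rho> * (1 / 2) powr (1 / p)) \<le> wasserstein p (empirical n X) (cube_measure a K)"
    using p \<rho> F(1) unfolding U_def by (intro wasserstein_ge) auto
  \<comment> \<open>As \<open>1 \<le> p\<close>, the root of the mass 1/2 is still at least 1/2, and
    the constant becomes free of \<open>p\<close>.\<close>
  have "(1 / 2 :: real) = (1 / 2) powr 1" by simp
  also have "\<dots> \<le> (1 / 2) powr (1 / p)" using p by (intro powr_mono') auto
  finally have "\<rho> * (1 / 2) \<le> \<rho> * (1 / 2) powr (1 / p)" using \<rho> by (intro mult_left_mono)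
  then have "ennreal (\<rho> * (1 / 2)) \<le> ennreal (\<rho> * (1 / 2) powr (1 / p))" by (rule ennreal_leI)
  then show ?thesis using * by (simp add: \<rho>_def)
qed

lemma SUP_expected_wasserstein_ge:
  assumes p: "1 \<le> p" and q: "0 < q" and b: "0 < b" and M: "0 < M" and n: "2 \<le> n"
  shows "ennreal (18 powr (- b) / 8 * M * ln (real n) powr (- b))
    \<le> (SUP \<mu>\<in>P_poly q b M. expected_wasserstein p n \<mu>)"
proof -
  define K where "K = nat \<lceil>8 * ln (2 * real n)\<rceil>"
  define a where "a = M * real K powr (- b - 1 / 2)"
  have ln2: "1 / 2 \<le> ln (2 :: real)" using ln_one_minus_pos_upper_bound[of "1/2 :: real"]
    by (simp add: ln_div)
  have lnn: "ln 2 \<le> ln (real n)" using n by simp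
  have ln2n: "ln (2 * real n) = ln 2 + ln (real n)" using n by (simp add: ln_mult)
  have K1: "8 * ln (2 * real n) \<le> real K" unfolding K_def by linarith
  have K0: "0 < K" using K1 ln2n ln2 lnn by (cases "K = 0") auto
  have "real K \<le> 8 * ln (2 * real n) + 1" using ln2n ln2 lnn unfolding K_def by linarith
  \<comment> \<open>Uses \<open>8 * ln 2 + 1 \<le> 10 * ln n\<close>, which follows from
    \<open>ln 2 \<le> ln n\<close> and \<open>1 \<le> 2 * ln 2\<close>.\<close>
  then have K2: "real K \<le> 18 * ln (real n)" using ln2n ln2 lnn by linarith
  have a: "0 < a" using M K0 by (simp add: a_def)
  have \<mu>: "cube_measure a K \<in> P_poly q b M"
    using M K0 b q a_def by (rule cube_measure_P_poly)
  have "18 powr (- b) * ln (real n) powr (- b) = (18 * ln (real n)) powr (- b)"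
    using ln2 lnn by (simp add: powr_mult)
  also have "\<dots> \<le> real K powr (- b)" using K0 K2 b by (intro powr_mono2') auto
  finally have "18 powr (- b) / 8 * M * ln (real n) powr (- b) \<le> M * real K powr (- b) / 8"
    using M by (simp add: field_simps)
  also have "\<dots> \<le> a * sqrt (real K / 8) / 2"
  proof -
    have "sqrt (real K) * real K powr (- b - 1 / 2) = real K powr (- b)"
      using K0 by (simp add: powr_half_sqrt[symmetric] powr_add[symmetric])
    then have "a * sqrt (real K / 8) / 2 = M * real K powr (- b) / (2 * sqrt 8)"
      by (simp add: a_def real_sqrt_divide field_simps)
    moreover have "sqrt 8 \<le> 4" by (rule real_le_lsqrt) auto
    ultimately show ?thesis using M K0 by (simp only:, intro divide_left_mono) auto
  qed
  finally have "ennreal (18 powr (- b) / 8 * M * ln (real n) powr (- b)) \<le> ennreal (a * sqrt (real K / 8) / 2)"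
    by (rule ennreal_leI)
  also have "\<dots> \<le> expected_wasserstein p n (cube_measure a K)"
    using p cube_measure_l2_prob n K1 a by (intro expected_wasserstein_ge wasserstein_empirical_cube_ge) auto
  also have "\<dots> \<le> (SUP \<mu>\<in>P_poly q b M. expected_wasserstein p n \<mu>)"
    using \<mu> by (rule SUP_upper)
  finally show ?thesis .
qed

section \<open>Coupling through a finite partition\<close>

text \<open>The kernel \<open>k\<close> is the density, relative to the product of \<open>u\<close> and \<open>v\<close>, of the maximal coupling.\<close>

lemma discrete_coupling_kernel:
  fixes u v :: "'c \<Rightarrow> real"
  assumes L: "finite L" and u: "\<And>z. 0 \<le> u z" "(\<Sum>z\<in>L. u z) = 1"
    and v: "\<And>z. 0 \<le> v z" "(\<Sum>z\<in>L. v z) = 1"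
  obtains k where "\<And>z w. 0 \<le> k z w"
    "\<And>z. z \<in> L \<Longrightarrow> 0 < u z \<Longrightarrow> (\<Sum>w\<in>L. k z w * v w) = 1"
    "\<And>w. w \<in> L \<Longrightarrow> 0 < v w \<Longrightarrow> (\<Sum>z\<in>L. k z w * u z) = 1"
    "(\<Sum>z\<in>L. \<Sum>w\<in>L. (if z = w then 0 else k z w) * v w * u z) \<le> (\<Sum>z\<in>L. \<bar>u z - v z\<bar>)"
proof -
  \<comment> \<open>\<open>m\<close> is the common part of the two laws, \<open>r\<close> the mass
    left over on either side; \<open>A\<close> and \<open>B\<close> are the densities of the
    excesses relative to \<open>u\<close> and \<open>v\<close>. The kernel leaves the common part on
    the diagonal and couples the excesses independently. Division by zero gives 0, the right value
    at labels without mass.\<close>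
  define m where "m = (\<lambda>z. min (u z) (v z))"
  define r where "r = (\<Sum>z\<in>L. u z - m z)"
  define A where "A = (\<lambda>z. (u z - m z) / u z)"
  define B where "B = (\<lambda>z. (v z - m z) / v z)"
  define k where "k = (\<lambda>z w. (if z = w then m z / (u z * v z) else 0) + A z * B w / r)"
  have m: "0 \<le> m z" "m z \<le> u z" "m z \<le> v z" for z
    using u(1)[of z] v(1)[of z] by (auto simp: m_def)
  have r': "r = (\<Sum>z\<in>L. v z - m z)"
    using u(2) v(2) by (simp add: r_def sum_subtractf)
  have r: "0 \<le> r" unfolding r_def using m by (intro sum_nonneg) simp
  have cu: "A z * u z = u z - m z" for z using m[of z] unfolding A_def by (cases "u z = 0") auto
  have cv: "B z * v z = v z - m z" for z using m[of z] unfolding B_def by (cases "v z = 0") auto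
  have dv: "m z / (u z * v z) * v z = m z / u z" for z using m[of z] by (cases "v z = 0") auto
  have du: "m z / (u z * v z) * u z = m z / v z" for z using m[of z] by (cases "u z = 0") auto
  \<comment> \<open>If nothing is left over, the second summand of \<open>k\<close> is a division by
    zero, hence 0, and the diagonal alone has the right marginals.\<close>
  have r0: "u z = m z \<and> v z = m z" if "r = 0" "z \<in> L" for z
    using that(1) unfolding r_def using r' that L m
    by (metis (mono_tags, lifting) diff_ge_0_iff_ge eq_iff_diff_eq_0 r_def sum_nonneg_eq_0_iff)
  have kn: "0 \<le> k z w" for z w
    unfolding k_def A_def B_def using m[of z] m[of w] u(1) v(1) r by (intro add_nonneg_nonneg) auto
  have row: "(\<Sum>w\<in>L. k z w * v w) = 1" if z: "z \<in> L" "0 < u z" for z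
  proof -
    have "(\<Sum>w\<in>L. k z w * v w) = (\<Sum>w\<in>L. (if z = w then m z / (u z * v z) * v z else 0) +
        A z / r * (B w * v w))"
      by (intro sum.cong) (auto simp: k_def distrib_right)
    also have "\<dots> = m z / u z + A z / r * r"
      by (simp only: cv dv sum.distrib sum_distrib_left[symmetric] r'[symmetric]) (use z L in simp)
    also have "\<dots> = 1" using r0[of z] z by (cases "r = 0") (auto simp: A_def field_simps)
    finally show ?thesis .
  qed
  have col: "(\<Sum>z\<in>L. k z w * u z) = 1" if w: "w \<in> L" "0 < v w" for w
  proof -
    have "(\<Sum>z\<in>L. k z w * u z) = (\<Sum>z\<in>L. (if z = w then m w / (u w * v w) * u w else 0) +
        B w / r * (A z * u z))"
      by (intro sum.cong) (auto simp: k_def distrib_right)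
    also have "\<dots> = m w / v w + B w / r * r"
      by (simp only: cu du sum.distrib sum_distrib_left[symmetric] r_def[symmetric]) (use w L in simp)
    also have "\<dots> = 1" using r0[of w] w by (cases "r = 0") (auto simp: B_def field_simps)
    finally show ?thesis .
  qed
  \<comment> \<open>Off the diagonal only the product of the excesses survives. Summed over all
    pairs it gives \<open>r * r / r\<close>, which is \<open>r\<close> also for
    \<open>r = 0\<close>.\<close>
  have "(\<Sum>z\<in>L. \<Sum>w\<in>L. (if z = w then 0 else k z w) * v w * u z) \<le>
      (\<Sum>z\<in>L. \<Sum>w\<in>L. (u z - m z) * (v w - m w) / r)"
  proof (intro sum_mono)
    fix z w
    have "(if z = w then 0 else k z w) * v w * u z \<le>
        (A z * u z) * (B w * v w) / r"
    proof (cases "z = w")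
      case True
      then show ?thesis unfolding cu cv using m[of z] m[of w] r by simp
    next
      case False
      then have "(if z = w then 0 else k z w) * v w * u z = (A z * u z) * (B w * v w) / r"
        by (simp add: k_def mult_ac)
      then show ?thesis by (rule eq_refl)
    qed
    then show "(if z = w then 0 else k z w) * v w * u z \<le> (u z - m z) * (v w - m w) / r"
      unfolding cu cv .
  qed
  also have "\<dots> = r"
    by (simp add: sum_divide_distrib[symmetric] sum_product[symmetric] r'[symmetric] r_def[symmetric])
  also have "\<dots> \<le> (\<Sum>z\<in>L. \<bar>u z - v z\<bar>)"
    unfolding r_def by (intro sum_mono) (auto simp: m_def)
  finally show ?thesis using that kn row col by blast
qed

section \<open>Transport along a coupling of the cell masses\<close>

lemma powr_add3_le:
  fixes a b c p :: real
  assumes "0 \<le> a" "0 \<le> b" "0 \<le> c" "1 \<le> p"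
  shows "(a + b + c) powr p \<le> 3 powr p * (a powr p + b powr p + c powr p)"
proof -
  define t where "t = max a (max b c)"
  have "(a + b + c) powr p \<le> (3 * t) powr p"
    using assms by (intro powr_mono2) (auto simp: t_def)
  also have "\<dots> = 3 powr p * t powr p" using assms by (simp add: powr_mult t_def)
  also have "t powr p \<le> a powr p + b powr p + c powr p"
    using assms by (auto simp: t_def max_def)
  finally show ?thesis by simp
qed

lemma nn_integral_finite_labels:
  assumes "prob_space M" "finite L" "\<And>x. lab x \<in> L" "\<And>z. z \<in> L \<Longrightarrow> lab -` {z} \<in> sets M"
    and F: "\<And>z. 0 \<le> F z"
  shows "(\<integral>\<^sup>+ x. ennreal (F (lab x)) \<partial>M) = ennreal (\<Sum>z\<in>L. F z * measure M (lab -` {z}))"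
proof -
  interpret prob_space M by fact
  have "ennreal (F (lab x)) = (\<Sum>z\<in>L. ennreal (F z) * indicator (lab -` {z}) x)" for x
    using assms by (subst sum.remove[of _ "lab x"]) (auto intro!: sum.neutral simp: indicator_def)
  then have "(\<integral>\<^sup>+ x. ennreal (F (lab x)) \<partial>M) = (\<Sum>z\<in>L. ennreal (F z) * emeasure M (lab -` {z}))"
    using assms(4) by (simp add: nn_integral_sum nn_integral_cmult_indicator)
  also have "\<dots> = (\<Sum>z\<in>L. ennreal (F z * measure M (lab -` {z})))"
    by (simp add: emeasure_eq_measure ennreal_mult' F)
  finally show ?thesis by (simp add: F)
qed

text \<open>The marginal identities of the kernel are available only at labels of positive mass;
  this makes them hold almost everywhere.\<close>

lemma AE_finite_labels_pos:
  assumes "prob_space M" "finite L" "\<And>x. lab x \<in> L" "\<And>z. z \<in> L \<Longrightarrow> lab -` {z} \<in> sets M"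
  shows "AE x in M. 0 < measure M (lab -` {lab x})"
proof -
  interpret prob_space M by fact
  have "AE x in M. \<forall>z\<in>L. measure M (lab -` {z}) = 0 \<longrightarrow> x \<notin> lab -` {z}"
  proof (rule AE_finite_allI[OF assms(2)])
    fix z assume "z \<in> L"
    show "AE x in M. measure M (lab -` {z}) = 0 \<longrightarrow> x \<notin> lab -` {z}"
    proof (cases "measure M (lab -` {z}) = 0")
      case True
      then have "lab -` {z} \<in> null_sets M"
        using assms(4)[OF \<open>z \<in> L\<close>] by (intro null_setsI) (simp_all add: emeasure_eq_measure)
      then have "AE x in M. x \<notin> lab -` {z}" by (rule AE_not_in)
      then show ?thesis by (rule eventually_mono) simp
    qed simp
  qed
  then show ?thesis
    by (rule eventually_mono) (use assms(3) in \<open>auto simp: zero_less_measure_iff less_le\<close>)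
qed

text \<open>The coupling has density \<open>k (lab x) (lab y)\<close> with respect to the product
  measure: labels are coupled maximally and, given the labels, the points are independent.
  \<open>D\<close> is paid only where the labels differ, an event of probability at most the
  \<open>l1\<close> distance of the cell masses.\<close>

lemma wasserstein_le_partition:
  fixes lab :: "l2 \<Rightarrow> 'c"
  assumes p: "1 \<le> p" and \<nu>: "\<nu> \<in> l2_prob" and \<mu>: "\<mu> \<in> l2_prob"
    and L: "finite L" and lab: "\<And>x. lab x \<in> L" and lab_sets: "\<And>z. z \<in> L \<Longrightarrow> lab -` {z} \<in> sets borel"
    and e [measurable]: "e \<in> borel_measurable borel" and e0: "\<And>x. 0 \<le> e x" and D: "0 \<le> D"
    and same: "\<And>x y. lab x = lab y \<Longrightarrow> norm (x - y) \<le> e x + e y"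
    and diff: "\<And>x y. norm (x - y) \<le> e x + e y + D"
  shows "wasserstein p \<nu> \<mu> \<le> ennreal_powr (ennreal (3 powr p) *
    ((\<integral>\<^sup>+ x. ennreal (e x powr p) \<partial>\<nu>) + (\<integral>\<^sup>+ x. ennreal (e x powr p) \<partial>\<mu>) +
     ennreal (D powr p * (\<Sum>z\<in>L. \<bar>measure \<nu> (lab -` {z}) - measure \<mu> (lab -` {z})\<bar>)))) (1 / p)"
proof -
  interpret N: prob_space \<nu> using \<nu> by (simp add: l2_prob_def)
  interpret M: prob_space \<mu> using \<mu> by (simp add: l2_prob_def)
  interpret NM: pair_sigma_finite \<nu> \<mu> ..
  have sN [measurable_cong, simp]: "sets \<nu> = sets borel" and sM [measurable_cong, simp]: "sets \<mu> = sets borel"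
    using \<nu> \<mu> by (auto simp: l2_prob_def)
  have spN: "space \<nu> = UNIV" and spM: "space \<mu> = UNIV"
    using sets_eq_imp_space_eq[OF sN] sets_eq_imp_space_eq[OF sM] by auto
  define u where "u = (\<lambda>z. measure \<nu> (lab -` {z}))"
  define v where "v = (\<lambda>z. measure \<mu> (lab -` {z}))"
  have sum1: "(\<Sum>z\<in>L. measure M' (lab -` {z})) = 1" if "prob_space M'" "sets M' = sets borel" for M'
  proof -
    interpret prob_space M' by fact
    have "1 = (\<integral>\<^sup>+ x. ennreal 1 \<partial>M')" by (simp add: emeasure_space_1)
    also have "\<dots> = ennreal (\<Sum>z\<in>L. 1 * measure M' (lab -` {z}))"
      using that L lab lab_sets by (intro nn_integral_finite_labels) auto
    finally show ?thesis by simp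
  qed
  obtain k where k: "\<And>z w. 0 \<le> k z w"
    "\<And>z. z \<in> L \<Longrightarrow> 0 < u z \<Longrightarrow> (\<Sum>w\<in>L. k z w * v w) = 1"
    "\<And>w. w \<in> L \<Longrightarrow> 0 < v w \<Longrightarrow> (\<Sum>z\<in>L. k z w * u z) = 1"
    "(\<Sum>z\<in>L. \<Sum>w\<in>L. (if z = w then 0 else k z w) * v w * u z) \<le> (\<Sum>z\<in>L. \<bar>u z - v z\<bar>)"
  proof (rule discrete_coupling_kernel[OF L, of u v])
    show "(\<Sum>z\<in>L. u z) = 1" "(\<Sum>z\<in>L. v z) = 1"
      unfolding u_def v_def by (auto intro: sum1 N.prob_space_axioms M.prob_space_axioms)
  qed (auto simp: u_def v_def)
  \<comment> \<open>The label type carries no sigma-algebra, so a function of two labels is expanded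
    into finitely many indicators of cells.\<close>
  have meas_lab [measurable]: "(\<lambda>z. F (lab (fst z)) (lab (snd z))) \<in> borel_measurable (borel \<Otimes>\<^sub>M borel)"
    for F :: "'c \<Rightarrow> 'c \<Rightarrow> real"
  proof -
    have [measurable]: "lab -` {z} \<in> sets borel" if "z \<in> L" for z using lab_sets that .
    have "(\<lambda>x. F (lab (fst x)) (lab (snd x))) =
      (\<lambda>x. \<Sum>z\<in>L. \<Sum>w\<in>L. F z w * indicator (lab -` {z}) (fst x) * indicator (lab -` {w}) (snd x))"
    proof
      fix x :: "l2 \<times> l2"
      have *: "(\<Sum>w\<in>L. F z w * indicator (lab -` {z}) (fst x) * indicator (lab -` {w}) (snd x)) =
        (if z = lab (fst x) then F z (lab (snd x)) else 0)" for z
        using L lab by (subst sum.remove[of _ "lab (snd x)"]) (auto intro!: sum.neutral simp: indicator_def)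
      show "F (lab (fst x)) (lab (snd x)) =
        (\<Sum>z\<in>L. \<Sum>w\<in>L. F z w * indicator (lab -` {z}) (fst x) * indicator (lab -` {w}) (snd x))"
        unfolding * using L lab by simp
    qed
    also have "\<dots> \<in> borel_measurable (borel \<Otimes>\<^sub>M borel)"
      by (intro borel_measurable_sum borel_measurable_times borel_measurable_const
        measurable_compose[OF measurable_fst borel_measurable_indicator]
        measurable_compose[OF measurable_snd borel_measurable_indicator] lab_sets)
    finally show ?thesis .
  qed
  define f where "f = (\<lambda>z. ennreal (k (lab (fst z)) (lab (snd z))))"
  have f [measurable]: "f \<in> borel_measurable (borel \<Otimes>\<^sub>M borel)" unfolding f_def by measurable
  define \<xi> where "\<xi> = density (\<nu> \<Otimes>\<^sub>M \<mu>) f"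
  have sets_nm [measurable_cong]: "sets (\<nu> \<Otimes>\<^sub>M \<mu>) = sets (borel \<Otimes>\<^sub>M borel)"
    by (intro sets_pair_measure_cong sN sM)
  have sets_\<xi> [measurable_cong]: "sets \<xi> = sets (borel \<Otimes>\<^sub>M borel)" by (simp add: \<xi>_def sets_nm)
  have int\<xi>: "(\<integral>\<^sup>+ z. h z \<partial>\<xi>) = (\<integral>\<^sup>+ z. f z * h z \<partial>(\<nu> \<Otimes>\<^sub>M \<mu>))"
    if [measurable]: "h \<in> borel_measurable (borel \<Otimes>\<^sub>M borel)" for h
    unfolding \<xi>_def by (subst nn_integral_density) auto
  have fst_int: "(\<integral>\<^sup>+ z. h (fst z) \<partial>\<xi>) = (\<integral>\<^sup>+ x. h x \<partial>\<nu>)"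
    if [measurable]: "h \<in> borel_measurable borel" for h
  proof -
    have "(\<integral>\<^sup>+ z. h (fst z) \<partial>\<xi>) = (\<integral>\<^sup>+ x. \<integral>\<^sup>+ y. f (x, y) * h x \<partial>\<mu> \<partial>\<nu>)"
      by (subst int\<xi>, measurable, subst M.nn_integral_fst[symmetric]) auto
    also have "\<dots> = (\<integral>\<^sup>+ x. h x * ennreal (\<Sum>w\<in>L. k (lab x) w * v w) \<partial>\<nu>)"
    proof (rule nn_integral_cong)
      fix x
      have [measurable]: "(\<lambda>y. k (lab x) (lab y)) \<in> borel_measurable borel"
        using measurable_compose[OF measurable_Pair1'[of x borel borel] meas_lab[of k]] by simp
      have "(\<integral>\<^sup>+ y. f (x, y) * h x \<partial>\<mu>) = (\<integral>\<^sup>+ y. ennreal (k (lab x) (lab y)) \<partial>\<mu>) * h x"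
        unfolding f_def fst_conv snd_conv
        by (subst nn_integral_multc) auto
      then show "(\<integral>\<^sup>+ y. f (x, y) * h x \<partial>\<mu>) = h x * ennreal (\<Sum>w\<in>L. k (lab x) w * v w)"
        using L lab lab_sets k(1) M.prob_space_axioms
        by (subst (asm) nn_integral_finite_labels[where L = L]) (auto simp: v_def mult.commute)
    qed
    also have "\<dots> = (\<integral>\<^sup>+ x. h x \<partial>\<nu>)"
      using AE_finite_labels_pos[where lab = lab, OF N.prob_space_axioms L lab] lab_sets
      by (intro nn_integral_cong_AE) (auto elim!: eventually_mono simp: k(2)[OF lab, unfolded u_def])
    finally show ?thesis .
  qed
  have snd_int: "(\<integral>\<^sup>+ z. h (snd z) \<partial>\<xi>) = (\<integral>\<^sup>+ x. h x \<partial>\<mu>)"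
    if [measurable]: "h \<in> borel_measurable borel" for h
  proof -
    have "(\<integral>\<^sup>+ z. h (snd z) \<partial>\<xi>) = (\<integral>\<^sup>+ y. \<integral>\<^sup>+ x. f (x, y) * h y \<partial>\<nu> \<partial>\<mu>)"
      by (subst int\<xi>, measurable, subst NM.nn_integral_snd[symmetric]) auto
    also have "\<dots> = (\<integral>\<^sup>+ y. h y * ennreal (\<Sum>z\<in>L. k z (lab y) * u z) \<partial>\<mu>)"
    proof (rule nn_integral_cong)
      fix y
      have [measurable]: "(\<lambda>x. k (lab x) (lab y)) \<in> borel_measurable borel"
        using measurable_compose[OF measurable_Pair2'[of y borel borel] meas_lab[of k]] by simp
      have "(\<integral>\<^sup>+ x. f (x, y) * h y \<partial>\<nu>) = (\<integral>\<^sup>+ x. ennreal (k (lab x) (lab y)) \<partial>\<nu>) * h y"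
        unfolding f_def fst_conv snd_conv
        by (subst nn_integral_multc) auto
      then show "(\<integral>\<^sup>+ x. f (x, y) * h y \<partial>\<nu>) = h y * ennreal (\<Sum>z\<in>L. k z (lab y) * u z)"
        using L lab lab_sets k(1) N.prob_space_axioms nn_integral_finite_labels[of \<nu> L lab "\<lambda>z. k z (lab y)"]
        by (auto simp: u_def mult.commute)
    qed
    also have "\<dots> = (\<integral>\<^sup>+ x. h x \<partial>\<mu>)"
      using AE_finite_labels_pos[where lab = lab, OF M.prob_space_axioms L lab] lab_sets
      by (intro nn_integral_cong_AE) (auto elim!: eventually_mono simp: k(3)[OF lab, unfolded v_def])
    finally show ?thesis .
  qed
  have sp\<xi>: "space \<xi> = UNIV" using sets_eq_imp_space_eq[OF sets_\<xi>] by (simp add: space_pair_measure)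
  have "\<xi> \<in> couplings \<nu> \<mu>"
    unfolding couplings_def mem_Collect_eq
  proof (intro conjI)
    show "prob_space \<xi>"
      using fst_int[of "\<lambda>_. 1"] by (intro prob_spaceI) (simp add: N.emeasure_space_1)
    show "sets \<xi> = sets (borel \<Otimes>\<^sub>M borel)" by (rule sets_\<xi>)
    show "distr \<xi> borel fst = \<nu>"
    proof (rule measure_eqI)
      fix A assume "A \<in> sets (distr \<xi> borel fst)"
      then have A [measurable]: "A \<in> sets borel" by simp
      have "emeasure (distr \<xi> borel fst) A = (\<integral>\<^sup>+ x. indicator A x \<partial>distr \<xi> borel fst)" by simp
      also have "\<dots> = (\<integral>\<^sup>+ z. indicator A (fst z) \<partial>\<xi>)" by (subst nn_integral_distr) auto
      also have "\<dots> = emeasure \<nu> A" by (subst fst_int) auto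
      finally show "emeasure (distr \<xi> borel fst) A = emeasure \<nu> A" .
    qed simp
    show "distr \<xi> borel snd = \<mu>"
    proof (rule measure_eqI)
      fix A assume "A \<in> sets (distr \<xi> borel snd)"
      then have A [measurable]: "A \<in> sets borel" by simp
      have "emeasure (distr \<xi> borel snd) A = (\<integral>\<^sup>+ x. indicator A x \<partial>distr \<xi> borel snd)" by simp
      also have "\<dots> = (\<integral>\<^sup>+ z. indicator A (snd z) \<partial>\<xi>)" by (subst nn_integral_distr) auto
      also have "\<dots> = emeasure \<mu> A" by (subst snd_int) auto
      finally show "emeasure (distr \<xi> borel snd) A = emeasure \<mu> A" .
    qed simp
  qed
  then have "wasserstein p \<nu> \<mu> \<le> ennreal_powr (\<integral>\<^sup>+ (x, y). ennreal (norm (x - y) powr p) \<partial>\<xi>) (1 / p)"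
    unfolding wasserstein_def by (rule INF_lower)
  also have "\<dots> \<le> ennreal_powr (ennreal (3 powr p) *
    ((\<integral>\<^sup>+ x. ennreal (e x powr p) \<partial>\<nu>) + (\<integral>\<^sup>+ x. ennreal (e x powr p) \<partial>\<mu>) +
     ennreal (D powr p * (\<Sum>z\<in>L. \<bar>u z - v z\<bar>)))) (1 / p)"
  proof (rule ennreal_powr_mono)
    define G where "G = (\<lambda>z w :: 'c. if z = w then 0 else 1 :: real)"
    have "(\<integral>\<^sup>+ (x, y). ennreal (norm (x - y) powr p) \<partial>\<xi>) \<le>
      (\<integral>\<^sup>+ z. ennreal (3 powr p) * (ennreal (e (fst z) powr p) + ennreal (e (snd z) powr p) +
        ennreal (D powr p) * ennreal (G (lab (fst z)) (lab (snd z)))) \<partial>\<xi>)"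
    proof (rule nn_integral_mono, clarify)
      fix x y
      have "norm (x - y) powr p \<le> (e x + e y + (if lab x = lab y then 0 else D)) powr p"
        using p same[of x y] diff[of x y] by (intro powr_mono2) auto
      also have "\<dots> \<le> 3 powr p * (e x powr p + e y powr p + (if lab x = lab y then 0 else D) powr p)"
        using e0 D p by (intro powr_add3_le) auto
      also have "(if lab x = lab y then 0 else D) powr p = D powr p * G (lab x) (lab y)"
        by (simp add: G_def)
      finally have "ennreal (norm (x - y) powr p) \<le>
          ennreal (3 powr p * (e x powr p + e y powr p + D powr p * G (lab x) (lab y)))" by (rule ennreal_leI)
      also have "\<dots> = ennreal (3 powr p) * (ennreal (e x powr p) + ennreal (e y powr p) +
          ennreal (D powr p) * ennreal (G (lab x) (lab y)))"
        by (simp add: ennreal_mult G_def)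
      finally show "ennreal (norm (x - y) powr p) \<le>
        ennreal (3 powr p) * (ennreal (e (fst (x, y)) powr p) + ennreal (e (snd (x, y)) powr p) +
          ennreal (D powr p) * ennreal (G (lab (fst (x, y))) (lab (snd (x, y)))))" by simp
    qed
    also have "\<dots> = ennreal (3 powr p) * ((\<integral>\<^sup>+ z. ennreal (e (fst z) powr p) \<partial>\<xi>) +
        (\<integral>\<^sup>+ z. ennreal (e (snd z) powr p) \<partial>\<xi>) +
        ennreal (D powr p) * (\<integral>\<^sup>+ z. ennreal (G (lab (fst z)) (lab (snd z))) \<partial>\<xi>))"
      by (subst nn_integral_cmult, measurable, subst nn_integral_add, measurable,
          subst nn_integral_add, measurable, subst nn_integral_cmult, measurable)
    also have "(\<integral>\<^sup>+ z. ennreal (e (fst z) powr p) \<partial>\<xi>) = (\<integral>\<^sup>+ x. ennreal (e x powr p) \<partial>\<nu>)"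
      by (subst fst_int) auto
    also have "(\<integral>\<^sup>+ z. ennreal (e (snd z) powr p) \<partial>\<xi>) = (\<integral>\<^sup>+ x. ennreal (e x powr p) \<partial>\<mu>)"
      by (subst snd_int) auto
    also have "(\<integral>\<^sup>+ z. ennreal (G (lab (fst z)) (lab (snd z))) \<partial>\<xi>) \<le> ennreal (\<Sum>z\<in>L. \<bar>u z - v z\<bar>)"
    proof -
      \<comment> \<open>The kernel without its diagonal; its integral is the probability of
        different labels, bounded by the last property of \<open>k\<close>.\<close>
      define k' where "k' = (\<lambda>z w. if z = w then 0 else k z w)"
      have k': "0 \<le> k' z w" for z w using k(1) by (simp add: k'_def)
      have "(\<integral>\<^sup>+ z. ennreal (G (lab (fst z)) (lab (snd z))) \<partial>\<xi>) =
          (\<integral>\<^sup>+ z. ennreal (k' (lab (fst z)) (lab (snd z))) \<partial>(\<nu> \<Otimes>\<^sub>M \<mu>))"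
        by (subst int\<xi>, measurable, intro nn_integral_cong) (auto simp: f_def G_def k'_def)
      also have "\<dots> = (\<integral>\<^sup>+ x. \<integral>\<^sup>+ y. ennreal (k' (lab x) (lab y)) \<partial>\<mu> \<partial>\<nu>)"
        by (subst M.nn_integral_fst[symmetric]) auto
      also have "\<dots> = (\<integral>\<^sup>+ x. ennreal (\<Sum>w\<in>L. k' (lab x) w * v w) \<partial>\<nu>)"
        using L lab lab_sets k' M.prob_space_axioms unfolding v_def
        by (intro nn_integral_cong nn_integral_finite_labels) auto
      also have "\<dots> = ennreal (\<Sum>z\<in>L. (\<Sum>w\<in>L. k' z w * v w) * u z)"
        using L lab lab_sets k' N.prob_space_axioms unfolding u_def
        by (intro nn_integral_finite_labels) (auto simp: v_def intro!: sum_nonneg)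
      also have "\<dots> \<le> ennreal (\<Sum>z\<in>L. \<bar>u z - v z\<bar>)"
        using k(4) by (intro ennreal_leI) (simp add: k'_def sum_distrib_right)
      finally show ?thesis .
    qed
    finally show "(\<integral>\<^sup>+ (x, y). ennreal (norm (x - y) powr p) \<partial>\<xi>) \<le> ennreal (3 powr p) *
    ((\<integral>\<^sup>+ x. ennreal (e x powr p) \<partial>\<nu>) + (\<integral>\<^sup>+ x. ennreal (e x powr p) \<partial>\<mu>) +
     ennreal (D powr p * (\<Sum>z\<in>L. \<bar>u z - v z\<bar>)))"
      by (simp add: ennreal_mult' mult_left_mono add_left_mono)
  qed (use p in simp)
  finally show ?thesis by (simp add: u_def v_def)
qed

section \<open>Averaging over the sample\<close>

lemma nn_integral_empirical:
  assumes [measurable]: "h \<in> borel_measurable borel"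
  shows "(\<integral>\<^sup>+ x. h x \<partial>empirical n X) = (\<Sum>i<n. h (X i) * ennreal (1 / real n))"
proof -
  have X: "X \<in> uniform_count_measure {..<n} \<rightarrow>\<^sub>M borel"
    by (auto simp: measurable_def space_uniform_count_measure sets_uniform_count_measure)
  show ?thesis
    unfolding empirical_def
    by (subst nn_integral_distr[OF X])
      (simp_all add: uniform_count_measure_def nn_integral_point_measure_finite mult.commute)
qed

lemma measure_empirical:
  assumes "A \<in> sets borel"
  shows "measure (empirical n X) A = (\<Sum>i<n. indicator A (X i)) / real n"
proof -
  have "real (card {i\<in>{..<n}. X i \<in> A}) = (\<Sum>i\<in>{i\<in>{..<n}. X i \<in> A}. 1)" by simp
  also have "\<dots> = (\<Sum>i<n. indicator A (X i))"
    by (intro sum.mono_neutral_cong_left) (auto simp: indicator_def)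
  finally show ?thesis
    using assms by (simp add: measure_def emeasure_empirical)
qed

lemma empirical_l2_prob: "0 < n \<Longrightarrow> empirical n X \<in> l2_prob"
  unfolding l2_prob_def empirical_def
  by (auto intro!: prob_space.prob_space_distr prob_space_uniform_count_measure
      simp: measurable_def space_uniform_count_measure sets_uniform_count_measure)

lemma nn_integral_PiM_component:
  assumes "prob_space M" "i \<in> I" and [measurable]: "h \<in> borel_measurable M"
  shows "(\<integral>\<^sup>+ X. h (X i) \<partial>(\<Pi>\<^sub>M i\<in>I. M)) = (\<integral>\<^sup>+ x. h x \<partial>M)"
proof -
  have "(\<integral>\<^sup>+ x. h x \<partial>M) = (\<integral>\<^sup>+ x. h x \<partial>distr (\<Pi>\<^sub>M i\<in>I. M) M (\<lambda>X. X i))"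
    using assms by (subst distr_PiM_component) auto
  also have "\<dots> = (\<integral>\<^sup>+ X. h (X i) \<partial>(\<Pi>\<^sub>M i\<in>I. M))"
    using assms by (subst nn_integral_distr) auto
  finally show ?thesis by simp
qed

text \<open>The centred indicators are bounded by 1 and uncorrelated under the product measure, so
  the second moment of their sum is at most \<open>n\<close>. The inequality of arithmetic and
  geometric means, in place of Cauchy-Schwarz, passes to the first absolute moment.\<close>

lemma nn_integral_PiM_frequency_deviation_le:
  assumes M: "prob_space M" and A [measurable]: "A \<in> sets M" and n: "0 < n"
  shows "(\<integral>\<^sup>+ X. ennreal \<bar>(\<Sum>i<n. indicator A (X i)) / real n - measure M A\<bar> \<partial>(\<Pi>\<^sub>M i\<in>{..<n}. M))
    \<le> ennreal (1 / sqrt (real n))"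
proof -
  interpret M: prob_space M by fact
  interpret product_sigma_finite "\<lambda>_ :: nat. M" by unfold_locales
  let ?P = "\<Pi>\<^sub>M i\<in>{..<n}. M"
  interpret P: prob_space ?P by (intro prob_space_PiM M)
  define \<phi> where "\<phi> = (\<lambda>x. indicator A x - measure M A)"
  have [measurable]: "\<phi> \<in> borel_measurable M" unfolding \<phi>_def by measurable
  have \<phi>1: "\<bar>\<phi> x\<bar> \<le> 1" for x by (auto simp: \<phi>_def indicator_def)
  have int\<phi>: "integrable M \<phi>" using \<phi>1 by (intro M.integrable_const_bound[of _ 1]) auto
  have E\<phi>: "(\<integral>x. \<phi> x \<partial>M) = 0" 
  proof -
    have "integrable M (indicator A :: _ \<Rightarrow> real)"
      by (intro M.integrable_const_bound[of _ 1]) auto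
    then show ?thesis unfolding \<phi>_def by (simp add: M.prob_space)
  qed
  have \<phi>\<phi>1: "\<bar>\<phi> x * \<phi> y\<bar> \<le> 1" for x y using \<phi>1[of x] \<phi>1[of y] by (simp add: abs_mult mult_le_one)
  have int2: "integrable ?P (\<lambda>X. \<phi> (X i) * \<phi> (X j))" if [simp]: "i < n" "j < n" for i j
    using \<phi>\<phi>1 by (intro P.integrable_const_bound[of _ 1]) auto
  have cross: "(\<integral>X. \<phi> (X i) * \<phi> (X j) \<partial>?P) \<le> (if i = j then 1 else 0)" if ij: "i < n" "j < n" for i j
  proof (cases "i = j")
    case True
    have "(\<integral>X. \<phi> (X i) * \<phi> (X j) \<partial>?P) \<le> (\<integral>X. 1 \<partial>?P)"
      using \<phi>\<phi>1 by (intro integral_mono int2 ij) (auto simp: abs_le_iff)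
    then show ?thesis using True by (simp add: P.prob_space)
  next
    case False
    \<comment> \<open>Factors 1 at the other indices turn the integrand into a product over the
      whole sample, whose integral factorizes; the factor at \<open>i\<close> integrates to
      0.\<close>
    let ?f = "\<lambda>k. if k \<in> {i, j} then \<phi> else (\<lambda>_. 1)"
    have "\<phi> (X i) * \<phi> (X j) = (\<Prod>k<n. ?f k (X k))" for X
    proof -
      have "(\<Prod>k<n. ?f k (X k)) = (\<Prod>k\<in>{i, j}. \<phi> (X k))"
        using ij by (intro prod.mono_neutral_cong_right) auto
      then show ?thesis using False by simp
    qed
    then have "(\<integral>X. \<phi> (X i) * \<phi> (X j) \<partial>?P) = (\<integral>X. (\<Prod>k<n. ?f k (X k)) \<partial>?P)" by simp
    also have "\<dots> = (\<Prod>k<n. \<integral>x. ?f k x \<partial>M)"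
      using int\<phi> by (intro product_integral_prod) auto
    also have "\<dots> = 0" using ij E\<phi> by (intro prod_zero) (auto intro!: bexI[of _ i])
    finally show ?thesis using False by simp
  qed
  let ?S = "\<lambda>X. \<Sum>i<n. \<phi> (X i)"
  have sq: "(?S X)\<^sup>2 = (\<Sum>i<n. \<Sum>j<n. \<phi> (X i) * \<phi> (X j))" for X
    by (simp add: power2_eq_square sum_product)
  have intS: "integrable ?P (\<lambda>X. (?S X)\<^sup>2)"
    unfolding sq by (intro Bochner_Integration.integrable_sum int2) auto
  have "(\<integral>X. (?S X)\<^sup>2 \<partial>?P) = (\<Sum>i<n. \<Sum>j<n. \<integral>X. \<phi> (X i) * \<phi> (X j) \<partial>?P)"
    unfolding sq using int2 by (subst Bochner_Integration.integral_sum, auto intro!: sum.cong)+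
  also have "\<dots> \<le> (\<Sum>i<n. \<Sum>j<n. if i = j then 1 else 0)"
    by (intro sum_mono cross) auto
  also have "\<dots> = real n" by simp
  finally have var: "(\<integral>X. (?S X)\<^sup>2 \<partial>?P) \<le> real n" .
  define c where "c = sqrt (real n)"
  have c: "0 < c" "c * c = real n" using n by (auto simp: c_def)
  \<comment> \<open>This is \<open>2 * c * \<bar>S\<bar> \<le> c^2 + S^2\<close> divided by
    \<open>2 * c ^ 3\<close>. With \<open>c = sqrt n\<close> both terms on the right have
    expectation at most \<open>1 / c\<close> before halving.\<close>
  have dev: "\<bar>(\<Sum>i<n. indicator A (X i)) / real n - measure M A\<bar> \<le> (1 / c + (?S X)\<^sup>2 / c ^ 3) / 2" for X
  proof -
    have "(\<Sum>i<n. indicator A (X i)) / real n - measure M A = ?S X / (c * c)"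
      using n unfolding c(2) by (simp add: \<phi>_def sum_subtractf field_simps)
    moreover have "0 \<le> (\<bar>?S X\<bar> - c)\<^sup>2" by simp
    then have "2 * (c * \<bar>?S X\<bar>) \<le> c\<^sup>2 + (?S X)\<^sup>2" by (simp add: power2_diff mult_ac add_ac)
    then have "\<bar>?S X\<bar> / (c * c) \<le> (1 / c + (?S X)\<^sup>2 / c ^ 3) / 2"
      using c(1) by (simp add: field_simps power2_eq_square power3_eq_cube)
    ultimately show ?thesis using c(1) by (simp add: abs_mult)
  qed
  have "(\<integral>\<^sup>+ X. ennreal \<bar>(\<Sum>i<n. indicator A (X i)) / real n - measure M A\<bar> \<partial>?P) \<le>
      (\<integral>\<^sup>+ X. ennreal ((1 / c + (?S X)\<^sup>2 / c ^ 3) / 2) \<partial>?P)"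
    by (intro nn_integral_mono ennreal_leI dev)
  also have "\<dots> = ennreal (\<integral>X. (1 / c + (?S X)\<^sup>2 / c ^ 3) / 2 \<partial>?P)"
    using c(1) intS by (intro nn_integral_eq_integral) auto
  also have "(\<integral>X. (1 / c + (?S X)\<^sup>2 / c ^ 3) / 2 \<partial>?P) = (1 / c + (\<integral>X. (?S X)\<^sup>2 \<partial>?P) / c ^ 3) / 2"
    using intS by (simp add: P.prob_space)
  also have "\<dots> \<le> (1 / c + real n / c ^ 3) / 2"
    using var c(1) by (intro divide_right_mono add_left_mono) auto
  also have "\<dots> = 1 / c" using c by (simp add: c(2)[symmetric] power3_eq_cube)
  finally show ?thesis by (simp add: c_def ennreal_leI)
qed

text \<open>A linear bound on the \<open>p\<close>-th root that replaces Jensen's inequality and needs no integrability.\<close>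

lemma ennreal_powr_inverse_le:
  assumes p: "1 \<le> p" and B: "0 < B"
  shows "ennreal_powr (ennreal (3 powr p) * G) (1 / p) \<le> ennreal (3 * B powr (1 / p)) * (1 + G * ennreal (1 / B))"
proof (cases G)
  case (real g)
  \<comment> \<open>For \<open>t = g / B\<close>, the root is at most 1 if \<open>t \<le> 1\<close>,
    and at most \<open>t\<close> otherwise.\<close>
  have "(g / B) powr (1 / p) \<le> 1 + g / B"
  proof (cases "g / B \<le> 1")
    case True
    then have "(g / B) powr (1 / p) \<le> 1 powr (1 / p)" using real B p by (intro powr_mono2) auto
    then show ?thesis using real B by (simp add: add_increasing2)
  next
    case False
    then have "(g / B) powr (1 / p) \<le> (g / B) powr 1" using p by (intro powr_mono) auto
    then show ?thesis using False by simp
  qed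
  then have "B powr (1 / p) * (g / B) powr (1 / p) \<le> B powr (1 / p) * (1 + g / B)"
    by (intro mult_left_mono) auto
  then have "3 * g powr (1 / p) \<le> 3 * B powr (1 / p) * (1 + g / B)"
    using B real powr_mult[of B "g / B" "1 / p"] by simp
  moreover have "(3 powr p * g) powr (1 / p) = 3 * g powr (1 / p)"
    using real p by (simp add: powr_mult powr_powr)
  moreover have "ennreal (3 * B powr (1 / p)) * (1 + G * ennreal (1 / B)) =
      ennreal (3 * B powr (1 / p) * (1 + g / B))"
    using real B by (simp add: ennreal_mult[symmetric] ennreal_plus[symmetric] ennreal_1[symmetric] del: ennreal_plus ennreal_1)
  ultimately show ?thesis
    using real B by (simp add: ennreal_mult[symmetric] ennreal_powr_ennreal ennreal_leI)
next
  case top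
  then show ?thesis using B by (simp add: ennreal_top_mult ennreal_mult_top)
qed

text \<open>\<open>e\<close> bounds the diameter of the cells, and \<open>D\<close> what a pair of points in different cells
  costs in addition.\<close>

lemma expected_wasserstein_le_partition:
  fixes lab :: "l2 \<Rightarrow> 'c"
  assumes p: "1 \<le> p" and \<mu>: "\<mu> \<in> l2_prob" and n: "0 < n"
    and L: "finite L" and lab: "\<And>x. lab x \<in> L" and lab_sets: "\<And>z. z \<in> L \<Longrightarrow> lab -` {z} \<in> sets borel"
    and e [measurable]: "e \<in> borel_measurable borel" and e0: "\<And>x. 0 \<le> e x" and D: "0 \<le> D"
    and same: "\<And>x y. lab x = lab y \<Longrightarrow> norm (x - y) \<le> e x + e y"
    and diff: "\<And>x y. norm (x - y) \<le> e x + e y + D"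
    and A: "(\<integral>\<^sup>+ x. ennreal (e x powr p) \<partial>\<mu>) \<le> ennreal A" "0 \<le> A"
    and B: "2 * A + D powr p * (real (card L) / sqrt (real n)) \<le> B" "0 < B"
  shows "expected_wasserstein p n \<mu> \<le> ennreal (6 * B powr (1 / p))"
proof -
  interpret M: prob_space \<mu> using \<mu> by (simp add: l2_prob_def)
  have sM [measurable_cong, simp]: "sets \<mu> = sets borel"
    using \<mu> by (auto simp: l2_prob_def)
  let ?P = "\<Pi>\<^sub>M i\<in>{..<n}. \<mu>"
  interpret P: prob_space ?P by (intro prob_space_PiM M.prob_space_axioms)
  \<comment> \<open>The bound of \<open>wasserstein_le_partition\<close> for the empirical measure
    of \<open>X\<close>, up to the factor \<open>3 powr p\<close>. It is an explicit measurable
    function of the sample, so its mean can be computed term by term.\<close>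
  define G where "G = (\<lambda>X. (\<Sum>i<n. ennreal (e (X i) powr p) * ennreal (1 / real n)) +
      (\<integral>\<^sup>+ x. ennreal (e x powr p) \<partial>\<mu>) + ennreal (D powr p) *
      (\<Sum>z\<in>L. ennreal \<bar>(\<Sum>i<n. indicator (lab -` {z}) (X i)) / real n - measure \<mu> (lab -` {z})\<bar>))"
  have ind [measurable]: "z \<in> L \<Longrightarrow> i < n \<Longrightarrow> (\<lambda>X. indicator (lab -` {z}) (X i) :: real) \<in> borel_measurable ?P" for z i
    using lab_sets[of z]
    by (intro measurable_compose[OF measurable_component_singleton[of i "{..<n}" "\<lambda>_. \<mu>"] borel_measurable_indicator]) auto
  have mG1 [measurable]: "(\<lambda>X. \<Sum>i<n. ennreal (e (X i) powr p) * ennreal (1 / real n)) \<in> borel_measurable ?P"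
    by measurable
  have mG2 [measurable]: "(\<lambda>X. ennreal \<bar>(\<Sum>i<n. indicator (lab -` {z}) (X i)) / real n - measure \<mu> (lab -` {z})\<bar>)
      \<in> borel_measurable ?P" if "z \<in> L" for z
    using that by measurable
  have mG3 [measurable]: "(\<lambda>X. \<Sum>z\<in>L. ennreal \<bar>(\<Sum>i<n. indicator (lab -` {z}) (X i)) / real n - measure \<mu> (lab -` {z})\<bar>)
      \<in> borel_measurable ?P"
    by (intro borel_measurable_sum mG2)
  have mG [measurable]: "G \<in> borel_measurable ?P" unfolding G_def by measurable
  have W: "wasserstein p (empirical n X) \<mu> \<le> ennreal (3 * B powr (1 / p)) * (1 + G X * ennreal (1 / B))" for X
  proof -
    have "wasserstein p (empirical n X) \<mu> \<le> ennreal_powr (ennreal (3 powr p) * G X) (1 / p)"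
      using wasserstein_le_partition[OF p empirical_l2_prob[OF n] \<mu> L lab lab_sets e e0 D same diff, of X]
      unfolding G_def
      by (simp add: nn_integral_empirical measure_empirical[OF lab_sets] ennreal_mult sum_nonneg cong: sum.cong)
    then show ?thesis using ennreal_powr_inverse_le[OF p B(2)] by (rule order.trans)
  qed
  have "(\<integral>\<^sup>+ X. G X \<partial>?P) = (\<Sum>i<n. (\<integral>\<^sup>+ x. ennreal (e x powr p) \<partial>\<mu>) * ennreal (1 / real n)) +
      (\<integral>\<^sup>+ x. ennreal (e x powr p) \<partial>\<mu>) + ennreal (D powr p) *
      (\<Sum>z\<in>L. \<integral>\<^sup>+ X. ennreal \<bar>(\<Sum>i<n. indicator (lab -` {z}) (X i)) / real n - measure \<mu> (lab -` {z})\<bar> \<partial>?P)"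
  proof -
    have "(\<integral>\<^sup>+ X. (\<Sum>i<n. ennreal (e (X i) powr p) * ennreal (1 / real n)) \<partial>?P) =
      (\<Sum>i<n. (\<integral>\<^sup>+ x. ennreal (e x powr p) \<partial>\<mu>) * ennreal (1 / real n))"
      using M.prob_space_axioms
      by (subst nn_integral_sum, simp, intro sum.cong refl, subst nn_integral_multc, simp)
        (auto simp: nn_integral_PiM_component[where h = "\<lambda>x. ennreal (e x powr p)"])
    then show ?thesis unfolding G_def
      by (subst nn_integral_add, measurable, subst nn_integral_add, measurable,
          subst nn_integral_cmult, measurable, subst nn_integral_sum)
        (auto simp: mG2 P.emeasure_space_1)
  qed
  \<comment> \<open>Each sample has law \<open>\<mu>\<close>, so the empirical error term has the
    same mean as the one under \<open>\<mu>\<close>; each cell frequency deviates by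
    \<open>1 / sqrt n\<close> at most.\<close>
  also have "\<dots> \<le> (\<Sum>i<n. ennreal A * ennreal (1 / real n)) + ennreal A + ennreal (D powr p) *
      (\<Sum>z\<in>L. ennreal (1 / sqrt (real n)))"
    using A lab_sets n M.prob_space_axioms
    by (intro add_mono mult_mono sum_mono nn_integral_PiM_frequency_deviation_le) auto
  also have "\<dots> = ennreal (2 * A + D powr p * (real (card L) / sqrt (real n)))"
    using A n by (simp add: ennreal_mult'[symmetric] ennreal_plus[symmetric] ennreal_of_nat_eq_real_of_nat del: ennreal_plus)
  also have "\<dots> \<le> ennreal B" by (intro ennreal_leI B)
  finally have G: "(\<integral>\<^sup>+ X. G X \<partial>?P) \<le> ennreal B" .
  have "expected_wasserstein p n \<mu> \<le> (\<integral>\<^sup>+ X. ennreal (3 * B powr (1 / p)) * (1 + G X * ennreal (1 / B)) \<partial>?P)"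
    unfolding expected_wasserstein_def by (intro nn_integral_mono W)
  also have "\<dots> = ennreal (3 * B powr (1 / p)) * (1 + (\<integral>\<^sup>+ X. G X \<partial>?P) * ennreal (1 / B))"
    by (subst nn_integral_cmult, measurable, subst nn_integral_add, measurable, subst nn_integral_multc, measurable)
      (simp add: P.emeasure_space_1)
  also have "\<dots> \<le> ennreal (3 * B powr (1 / p)) * (1 + ennreal B * ennreal (1 / B))"
    by (intro mult_left_mono add_left_mono mult_right_mono G) auto
  \<comment> \<open>\<open>B\<close> normalizes the mean of \<open>G\<close> to at most 1, whence
    the constant \<open>6 = 3 * (1 + 1)\<close>.\<close>
  also have "ennreal B * ennreal (1 / B) = 1" using B by (simp add: ennreal_mult'[symmetric])
  also have "ennreal (3 * B powr (1 / p)) * (1 + 1) = ennreal (6 * B powr (1 / p))"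
    by (simp add: one_add_one ennreal_mult'[symmetric] flip: ennreal_numeral)
  finally show ?thesis .
qed

section \<open>Quantization of ellipsoids\<close>

lemma power_div_fact_le_exp: "0 \<le> x \<Longrightarrow> x ^ n / fact n \<le> exp x" for x :: real
proof -
  assume x: "0 \<le> x"
  have "x ^ n / fact n = (\<Sum>k\<in>{n}. x ^ k /\<^sub>R fact k)" by (simp add: divide_inverse)
  also have "\<dots> \<le> (\<Sum>k. x ^ k /\<^sub>R fact k)"
    using x by (intro sum_le_suminf summable_exp_generic) auto
  finally show ?thesis by (simp add: exp_def)
qed

text \<open>Two geometric series of ratio \<open>exp (- t)\<close>, with 0 counted twice. Since
  \<open>exp (- t) \<le> 1 / (1 + t) \<le> 1 - t / 2\<close>, the latter by
  \<open>t \<le> 1\<close>, each is at most \<open>2 / t\<close>.\<close>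

lemma sum_exp_abs_int_le:
  assumes t: "0 < t" "t \<le> 1"
  shows "(\<Sum>z\<in>{- int N..int N}. exp (- t * real_of_int \<bar>z\<bar>)) \<le> 4 / t"
proof -
  define r where "r = exp (- t)"
  have r: "0 < r" "r < 1" using t by (auto simp: r_def)
  have "r \<le> 1 / (1 + t)"
    using exp_ge_add_one_self[of t] t by (simp add: r_def exp_minus field_simps)
  also have "\<dots> \<le> 1 - t / 2" using t by (simp add: field_simps power2_eq_square)
  finally have r': "t / 2 \<le> 1 - r" by simp
  have pow: "exp (- t * real k) = r ^ k" for k by (simp add: r_def exp_of_nat_mult[symmetric] mult.commute)
  have geo: "(\<Sum>k\<le>N. r ^ k) \<le> 2 / t"
  proof -
    have "(\<Sum>k\<le>N. r ^ k) \<le> (\<Sum>k. r ^ k)"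
      using r by (intro sum_le_suminf summable_geometric) auto
    also have "\<dots> = 1 / (1 - r)" using r by (simp add: suminf_geometric)
    also have "\<dots> \<le> 1 / (t / 2)" using r' t r by (intro divide_left_mono) auto
    finally show ?thesis by simp
  qed
  have "{- int N..int N} = int ` {..N} \<union> (\<lambda>k. - int k) ` {..N}"
  proof (intro set_eqI iffI)
    fix z assume "z \<in> {- int N..int N}"
    then show "z \<in> int ` {..N} \<union> (\<lambda>k. - int k) ` {..N}"
      by (cases z rule: int_cases2) auto
  qed auto
  then have "(\<Sum>z\<in>{- int N..int N}. exp (- t * real_of_int \<bar>z\<bar>)) \<le>
      (\<Sum>z\<in>int ` {..N}. exp (- t * real_of_int \<bar>z\<bar>)) + (\<Sum>z\<in>(\<lambda>k. - int k) ` {..N}. exp (- t * real_of_int \<bar>z\<bar>))"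
    by (simp only: sum_Un[OF finite_imageI[OF finite_atMost] finite_imageI[OF finite_atMost]])
      (simp add: sum_nonneg)
  also have "\<dots> = (\<Sum>k\<le>N. r ^ k) + (\<Sum>k\<le>N. r ^ k)"
    by (subst (1 2) sum.reindex) (auto simp: inj_on_def pow[simplified])
  finally show ?thesis using geo by simp
qed

text \<open>A weighted \<open>l1\<close> ball rather than an ellipsoid, so that the generating
  function splits into geometric sums. The radius is \<open>K\<close> from Cauchy-Schwarz plus
  \<open>K\<close> from rounding, see \<open>code_in_code_lattice\<close>.\<close>

definition code_lattice :: "nat \<Rightarrow> real \<Rightarrow> (nat \<Rightarrow> int) set"
  where "code_lattice K b = {z \<in> {..<K} \<rightarrow>\<^sub>E UNIV.
    (\<Sum>m<K. (real (Suc m) / real K) powr b * real_of_int \<bar>z m\<bar>) \<le> 2 * real K}"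

text \<open>A box would lose a factor \<open>K\<^bsup>K/2\<^esup>\<close>; instead the points are counted with the generating function
  \<open>\<Sum>z. exp (- (\<Sum>m<K. t m * \<bar>z m\<bar>))\<close>, which factorizes over the coordinates.\<close>

lemma card_code_lattice:
  assumes K: "0 < K" and b: "0 < b"
  shows "finite (code_lattice K b)" "real (card (code_lattice K b)) \<le> exp ((4 + b) * real K)"
proof -
  define t where "t = (\<lambda>m. (real (Suc m) / real K) powr b)"
  have t: "0 < t m" for m using K by (simp add: t_def)
  have t1: "t m \<le> 1" if "m < K" for m
    using that b by (auto simp: t_def powr_le1)
  \<comment> \<open>A box around the ball, which makes the sums finite; the coordinate sums are then
    bounded uniformly in \<open>N\<close>.\<close>
  define N where "N = nat \<lceil>Max ((\<lambda>m. 2 * real K / t m) ` {..<K})\<rceil>"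
  define S where "S = {..<K} \<rightarrow>\<^sub>E {- int N..int N}"
  have finS: "finite S" unfolding S_def by (intro finite_PiE) auto
  have sub: "code_lattice K b \<subseteq> S"
  proof
    fix z assume z: "z \<in> code_lattice K b"
    have "z m \<in> {- int N..int N}" if m: "m < K" for m
    proof -
      have "t m * real_of_int \<bar>z m\<bar> \<le> (\<Sum>m<K. t m * real_of_int \<bar>z m\<bar>)"
        using m t by (intro member_le_sum) (auto simp: less_imp_le)
      also have "\<dots> \<le> 2 * real K" using z by (simp add: code_lattice_def t_def)
      finally have "real_of_int \<bar>z m\<bar> \<le> 2 * real K / t m" using t[of m] by (simp add: field_simps)
      also have "\<dots> \<le> Max ((\<lambda>m. 2 * real K / t m) ` {..<K})" using m by (intro Max_ge) auto
      finally have "\<bar>z m\<bar> \<le> int N" unfolding N_def by linarith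
      then show ?thesis by auto
    qed
    then show "z \<in> S" using z by (auto simp: S_def code_lattice_def PiE_iff)
  qed
  then show fin: "finite (code_lattice K b)" using finS by (rule finite_subset)
  have "real (card (code_lattice K b)) = (\<Sum>z\<in>code_lattice K b. 1)" by simp
  \<comment> \<open>The exponent is nonnegative on the ball, so every member has weight at least
    1.\<close>
  also have "\<dots> \<le> (\<Sum>z\<in>code_lattice K b. exp (2 * real K - (\<Sum>m<K. t m * real_of_int \<bar>z m\<bar>)))"
    by (intro sum_mono) (auto simp: code_lattice_def t_def)
  also have "\<dots> \<le> (\<Sum>z\<in>S. exp (2 * real K - (\<Sum>m<K. t m * real_of_int \<bar>z m\<bar>)))"
    using sub finS by (intro sum_mono2) auto
  also have "\<dots> = exp (2 * real K) * (\<Sum>z\<in>S. \<Prod>m<K. exp (- t m * real_of_int \<bar>z m\<bar>))"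
    unfolding sum_distrib_left
    by (intro sum.cong refl) (simp add: exp_sum[symmetric] sum_negf exp_add[symmetric])
  also have "(\<Sum>z\<in>S. \<Prod>m<K. exp (- t m * real_of_int \<bar>z m\<bar>)) =
      (\<Prod>m<K. \<Sum>z\<in>{- int N..int N}. exp (- t m * real_of_int \<bar>z\<bar>))"
    unfolding S_def by (subst prod_sum_PiE) auto
  also have "\<dots> \<le> (\<Prod>m<K. 4 * (real K / real (Suc m)) powr b)"
  proof (intro prod_mono conjI)
    fix m assume m: "m \<in> {..<K}"
    have "(\<Sum>z\<in>{- int N..int N}. exp (- t m * real_of_int \<bar>z\<bar>)) \<le> 4 / t m"
      using t t1 m by (intro sum_exp_abs_int_le) auto
    also have "\<dots> = 4 * (real K / real (Suc m)) powr b"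
      using K by (simp add: t_def powr_divide)
    finally show "(\<Sum>z\<in>{- int N..int N}. exp (- t m * real_of_int \<bar>z\<bar>)) \<le> 4 * (real K / real (Suc m)) powr b" .
  qed (auto intro: sum_nonneg)
  also have "\<dots> = 4 ^ K * (\<Prod>m<K. real K / real (Suc m)) powr b"
    by (simp add: prod.distrib prod_powr_distrib)
  \<comment> \<open>This quotient is one term of the series of \<open>exp K\<close>, so its power
    contributes \<open>exp (b * K)\<close>. The remaining \<open>4 * K\<close> in the exponent is
    \<open>2 * K\<close> from the radius and \<open>2 * K\<close> from \<open>4 ^ K\<close>.\<close>
  also have "(\<Prod>m<K. real K / real (Suc m)) = real K ^ K / fact K"
    by (simp add: prod_dividef fact_prod_Suc atLeast0LessThan)
  also have "4 ^ K * (real K ^ K / fact K) powr b \<le> exp (2 * real K) * exp (real K) powr b"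
  proof (intro mult_mono powr_mono2 power_div_fact_le_exp)
    have "(2 :: real) \<le> exp 1" using exp_ge_add_one_self[of "1 :: real"] by simp
    then have "(2 :: real) ^ 2 \<le> exp 1 ^ 2" by (intro power_mono) auto
    then have "4 \<le> exp (2 :: real)" by (simp add: exp_of_nat_mult[symmetric])
    then have "4 ^ K \<le> exp (2 :: real) ^ K" by (intro power_mono) auto
    then show "4 ^ K \<le> exp (2 * real K)" by (simp add: exp_of_nat_mult[symmetric] mult.commute)
  qed (use b in auto)
  also have "exp (2 * real K) * (exp (2 * real K) * exp (real K) powr b) = exp ((4 + b) * real K)"
    by (simp add: powr_def exp_add[symmetric] algebra_simps)
  finally show "real (card (code_lattice K b)) \<le> exp ((4 + b) * real K)" by simp
qed

section \<open>The weighted norm and truncation\<close>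

definition poly_weight :: "real \<Rightarrow> l2 \<Rightarrow> ennreal"
  where "poly_weight b x = (\<Sum>m. ennreal ((real (Suc m) powr b * coord x m)\<^sup>2))"

text \<open>Meaningful only where \<^const>\<open>poly_weight\<close> is finite: \<^const>\<open>enn2real\<close> maps \<open>\<top>\<close> to \<open>0\<close>.\<close>

definition poly_norm :: "real \<Rightarrow> l2 \<Rightarrow> real"
  where "poly_norm b x = sqrt (enn2real (poly_weight b x))"

lemma measurable_poly_weight [measurable]: "poly_weight b \<in> borel_measurable borel"
  unfolding poly_weight_def by measurable

lemma measurable_poly_norm [measurable]: "poly_norm b \<in> borel_measurable borel"
  unfolding poly_norm_def by measurable

lemma poly_norm_nonneg [simp]: "0 \<le> poly_norm b x"
  by (simp add: poly_norm_def)

lemma poly_norm_sums: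
  assumes "poly_weight b x < \<top>"
  shows "summable (\<lambda>m. (real (Suc m) powr b * coord x m)\<^sup>2)"
    "(poly_norm b x)\<^sup>2 = (\<Sum>m. (real (Suc m) powr b * coord x m)\<^sup>2)"
proof -
  show *: "summable (\<lambda>m. (real (Suc m) powr b * coord x m)\<^sup>2)"
    using assms unfolding poly_weight_def by (intro summable_suminf_not_top) auto
  show "(poly_norm b x)\<^sup>2 = (\<Sum>m. (real (Suc m) powr b * coord x m)\<^sup>2)"
    unfolding poly_norm_def poly_weight_def
    using * by (subst suminf_ennreal2) (auto simp: suminf_nonneg)
qed

text \<open>The discarded coordinates \<open>m \<ge> K\<close> carry weights
  \<open>real (Suc m) powr b\<close>, which are at least \<open>real (Suc K) powr b\<close>.\<close>

lemma norm_l2_tail_le: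
  assumes "poly_weight b x < \<top>" "0 < b"
  shows "norm (x - l2_of_fun K (coord x)) \<le> real (Suc K) powr (- b) * poly_norm b x"
proof (rule power2_le_imp_le)
  note s = poly_norm_sums[OF assms(1)]
  have "(norm (x - l2_of_fun K (coord x)))\<^sup>2 = (\<Sum>m. (coord (x - l2_of_fun K (coord x)) m)\<^sup>2)"
    by (rule norm_l2_sq)
  also have "\<dots> \<le> (\<Sum>m. (real (Suc K) powr (- b))\<^sup>2 * (real (Suc m) powr b * coord x m)\<^sup>2)"
  proof (intro suminf_le summable_coord_sq summable_mult s)
    fix m
    show "(coord (x - l2_of_fun K (coord x)) m)\<^sup>2 \<le> (real (Suc K) powr (- b))\<^sup>2 * (real (Suc m) powr b * coord x m)\<^sup>2"
    proof (cases "m < K")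
      case False
      then have "real (Suc K) powr b \<le> real (Suc m) powr b"
        using assms(2) by (intro powr_mono2) auto
      then have "1 \<le> real (Suc K) powr (- b) * real (Suc m) powr b"
        by (simp add: powr_minus field_simps)
      then have "1 \<le> (real (Suc K) powr (- b) * real (Suc m) powr b)\<^sup>2" by (rule one_le_power)
      then have "1 * (coord x m)\<^sup>2 \<le> (real (Suc K) powr (- b) * real (Suc m) powr b)\<^sup>2 * (coord x m)\<^sup>2"
        by (rule mult_right_mono) simp
      then show ?thesis using False by (simp add: power_mult_distrib mult_ac)
    qed simp
  qed
  also have "\<dots> = (real (Suc K) powr (- b) * poly_norm b x)\<^sup>2"
    using s by (simp add: suminf_mult power_mult_distrib)
  finally show "(norm (x - l2_of_fun K (coord x)))\<^sup>2 \<le> (real (Suc K) powr (- b) * poly_norm b x)\<^sup>2" .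
qed simp

lemma norm_le_poly_norm:
  assumes "poly_weight b x < \<top>" "0 < b"
  shows "norm x \<le> poly_norm b x"
proof -
  have "l2_of_fun 0 (coord x) = 0" by (intro l2_eqI) simp
  then show ?thesis using norm_l2_tail_le[OF assms, of 0] by simp
qed

lemma norm_l2_of_fun: "(norm (l2_of_fun K f))\<^sup>2 = (\<Sum>m<K. (f m)\<^sup>2)"
  unfolding norm_l2_sq by (subst suminf_finite[of "{..<K}"]) auto

section \<open>The quantizer\<close>

text \<open>Finiteness is demanded separately because \<open>poly_norm\<close> is 0 at points of
  infinite weight. The strict inequality keeps the levels of these points within
  \<open>J\<close>.\<close>

definition in_range :: "real \<Rightarrow> real \<Rightarrow> nat \<Rightarrow> l2 \<Rightarrow> bool"
  where "in_range b M J x \<longleftrightarrow> poly_weight b x < \<top> \<and> poly_norm b x < M * real J"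

text \<open>The first term pays for mesh and tail inside a cell, with \<open>M\<close> for rounding
  the weighted norm up to its level. All points out of range share one unbounded cell and are
  charged their full norm.\<close>

definition quant_error :: "real \<Rightarrow> real \<Rightarrow> nat \<Rightarrow> nat \<Rightarrow> l2 \<Rightarrow> real"
  where "quant_error b M K J x =
    2 * real K powr (- b) * (M + poly_norm b x) + (if in_range b M J x then 0 else norm x)"

text \<open>The number \<open>j\<close> of the shell
  \<open>M * (j - 1) \<le> poly_norm b x < M * j\<close>; it starts at 1, so that the mesh of the
  code is positive.\<close>

definition level :: "real \<Rightarrow> real \<Rightarrow> l2 \<Rightarrow> nat"
  where "level b M x = Suc (nat \<lfloor>poly_norm b x / M\<rfloor>)"

text \<open>The mesh grows with the level, so the error is proportional to
  \<open>M + poly_norm b x\<close> instead of the outer radius \<open>M * J\<close>, and one code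
  lattice serves all shells. The factor \<open>K powr (- 1 / 2)\<close> compensates for summing
  \<open>K\<close> squared coordinate errors.\<close>

definition code :: "real \<Rightarrow> real \<Rightarrow> nat \<Rightarrow> l2 \<Rightarrow> nat \<Rightarrow> int"
  where "code b M K x = (\<lambda>m\<in>{..<K}. \<lfloor>coord x m / (M * real (level b M x) * real K powr (- b - 1 / 2))\<rfloor>)"

definition label :: "real \<Rightarrow> real \<Rightarrow> nat \<Rightarrow> nat \<Rightarrow> l2 \<Rightarrow> (nat \<times> (nat \<Rightarrow> int)) option"
  where "label b M K J x = (if in_range b M J x then Some (level b M x, code b M K x) else None)"

definition labels :: "real \<Rightarrow> nat \<Rightarrow> nat \<Rightarrow> (nat \<times> (nat \<Rightarrow> int)) option set"
  where "labels b K J = insert None (Some ` ({1..J} \<times> code_lattice K b))"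

lemma level_pos: "0 < real (level b M x)"
  by (simp only: level_def of_nat_0_less_iff zero_less_Suc)

lemma level_bounds:
  assumes "0 < M"
  shows "poly_norm b x \<le> M * real (level b M x)" "M * real (level b M x) \<le> M + poly_norm b x"
proof -
  have 0: "0 \<le> poly_norm b x / M" using assms by simp
  have "poly_norm b x / M \<le> real (level b M x)" "real (level b M x) \<le> 1 + poly_norm b x / M"
    unfolding level_def using 0 by linarith+
  then show "poly_norm b x \<le> M * real (level b M x)" "M * real (level b M x) \<le> M + poly_norm b x"
    using assms by (auto simp: field_simps)
qed

lemma level_le:
  assumes "0 < M" "in_range b M J x"
  shows "level b M x \<le> J"
proof -
  have "poly_norm b x / M < real J" "0 \<le> poly_norm b x / M"
    using assms by (auto simp: in_range_def field_simps)
  then show ?thesis unfolding level_def by linarith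
qed

text \<open>Cauchy-Schwarz bounds the weighted \<open>l1\<close> norm of the leading coordinates by
  \<open>sqrt K * A\<close>. Dividing by the mesh gives \<open>K\<close>, and rounding adds at most
  1 per coordinate because the weights \<open>t m\<close> are at most 1.\<close>

lemma code_in_code_lattice:
  assumes M: "0 < M" and K: "0 < K" and b: "0 < b" and w: "poly_weight b x < \<top>"
  shows "code b M K x \<in> code_lattice K b"
proof -
  define A where "A = M * real (level b M x)"
  have A: "0 < A" using M level_pos[of b M x] by (simp add: A_def)
  have gA: "poly_norm b x \<le> A" using level_bounds(1)[OF M] by (simp add: A_def)
  define h where "h = real K powr (- b - 1 / 2)"
  have h: "0 < h" using K by (simp add: h_def)
  define t where "t = (\<lambda>m. (real (Suc m) / real K) powr b)"
  have t: "0 \<le> t m" for m by (simp add: t_def)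
  have t1: "t m \<le> 1" if "m < K" for m using that b by (auto simp: t_def powr_le1)
  let ?y = "\<lambda>m. real (Suc m) powr b * \<bar>coord x m\<bar>"
  have "(\<Sum>m<K. ?y m)\<^sup>2 \<le> real K * (\<Sum>m<K. (?y m)\<^sup>2)"
    using sum_squared_le_sum_of_squares[of ?y "{..<K}"] by (simp only: card_lessThan mult.commute)
  also have "(\<Sum>m<K. (?y m)\<^sup>2) = (\<Sum>m<K. (real (Suc m) powr b * coord x m)\<^sup>2)"
    by (simp add: power_mult_distrib)
  also have "\<dots> \<le> (poly_norm b x)\<^sup>2"
    unfolding poly_norm_sums(2)[OF w] by (intro sum_le_suminf poly_norm_sums(1)[OF w]) auto
  also have "\<dots> \<le> A\<^sup>2" using gA by (intro power_mono) auto
  finally have "(\<Sum>m<K. ?y m)\<^sup>2 \<le> (sqrt (real K) * A)\<^sup>2"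
    using K by (simp add: power_mult_distrib)
  then have cs: "(\<Sum>m<K. ?y m) \<le> sqrt (real K) * A"
    by (rule power2_le_imp_le) (use A in simp)
  have "(\<Sum>m<K. t m * real_of_int \<bar>code b M K x m\<bar>) \<le> (\<Sum>m<K. real K powr (- b) / (A * h) * ?y m + 1)"
  proof (rule sum_mono)
    fix m assume m: "m \<in> {..<K}"
    define c where "c = coord x m / (A * h)"
    have "code b M K x m = \<lfloor>c\<rfloor>" using m by (simp add: code_def A_def h_def c_def)
    then have "real_of_int \<bar>code b M K x m\<bar> \<le> \<bar>c\<bar> + 1" by linarith
    then have "t m * real_of_int \<bar>code b M K x m\<bar> \<le> t m * (\<bar>c\<bar> + 1)"
      by (rule mult_left_mono) (rule t)
    also have "\<dots> \<le> t m * \<bar>c\<bar> + 1" using t1 m by (simp add: distrib_left)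
    also have "t m * \<bar>c\<bar> = real K powr (- b) / (A * h) * ?y m"
      using A h K by (simp add: t_def c_def abs_mult powr_divide powr_minus field_simps)
    finally show "t m * real_of_int \<bar>code b M K x m\<bar> \<le> real K powr (- b) / (A * h) * ?y m + 1" .
  qed
  also have "\<dots> = real K powr (- b) / (A * h) * (\<Sum>m<K. ?y m) + real K"
    by (simp add: sum.distrib sum_distrib_left)
  also have "\<dots> \<le> real K powr (- b) / (A * h) * (sqrt (real K) * A) + real K"
    using A h by (intro add_right_mono mult_left_mono cs) auto
  also have "real K powr (- b) / (A * h) * (sqrt (real K) * A) = real K"
  proof -
    have "real K powr (- b) * sqrt (real K) = real K powr (- b + 1 / 2)"
      using K by (simp only: powr_add powr_half_sqrt of_nat_0_le_iff)
    also have "\<dots> = real K powr 1 * h" unfolding h_def powr_add[symmetric] by simp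
    finally show ?thesis using A h K by (simp add: field_simps)
  qed
  finally show ?thesis by (simp add: code_lattice_def t_def code_def)
qed

lemma label_in_labels:
  assumes "0 < M" "0 < K" "0 < b"
  shows "label b M K J x \<in> labels b K J"
  using assms code_in_code_lattice[of M K b x] level_le[of M b J x]
  by (auto simp: label_def labels_def in_range_def level_def)

lemma finite_labels:
  assumes "0 < K" "0 < b"
  shows "finite (labels b K J)" "real (card (labels b K J)) \<le> 1 + real J * exp ((4 + b) * real K)"
proof -
  note c = card_code_lattice[OF assms]
  show "finite (labels b K J)" using c by (simp add: labels_def)
  have "card (labels b K J) \<le> 1 + J * card (code_lattice K b)"
    unfolding labels_def using c
    by (intro order.trans[OF card_insert_le_m1]) (auto simp: card_image card_cartesian_product)
  then have "real (card (labels b K J)) \<le> 1 + real J * real (card (code_lattice K b))"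
    by (metis of_nat_1 of_nat_add of_nat_le_iff of_nat_mult)
  also have "\<dots> \<le> 1 + real J * exp ((4 + b) * real K)"
    using c by (intro add_left_mono mult_left_mono) auto
  finally show "real (card (labels b K J)) \<le> 1 + real J * exp ((4 + b) * real K)" .
qed

lemma measurable_in_range [measurable]: "Measurable.pred borel (in_range b M J)"
  unfolding in_range_def by measurable

lemma measurable_quant_error [measurable]: "quant_error b M K J \<in> borel_measurable borel"
  unfolding quant_error_def by measurable

lemma label_vimage_sets:
  assumes "z \<in> labels b K J"
  shows "label b M K J -` {z} \<in> sets borel"
proof (cases z)
  case None
  then have "label b M K J -` {z} = {x\<in>space borel. \<not> in_range b M J x}"
    by (auto simp: label_def split: if_splits)
  also have "\<dots> \<in> sets borel" by measurable
  finally show ?thesis .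
next
  case (Some jf)
  obtain j f where jf: "z = Some (j, f)" using Some by (cases jf) auto
  \<comment> \<open>Extensionality reduces equality of codes to finitely many measurable equations,
    one for each index below \<open>K\<close>.\<close>
  then have f: "f \<in> extensional {..<K}"
    using assms by (auto simp: labels_def code_lattice_def PiE_iff)
  have [measurable]: "level b M \<in> measurable borel (count_space UNIV)"
    unfolding level_def by measurable
  have "label b M K J -` {z} = {x\<in>space borel. in_range b M J x \<and> level b M x = j \<and>
     (\<forall>m\<in>{..<K}. \<lfloor>coord x m / (M * real (level b M x) * real K powr (- b - 1 / 2))\<rfloor> = f m)}"
    using f jf by (auto simp: label_def code_def fun_eq_iff extensional_def split: if_splits)
  also have "\<dots> \<in> sets borel" by measurable
  finally show ?thesis .
qed

lemma quant_error_nonneg: "0 < M \<Longrightarrow> 0 \<le> quant_error b M K J x"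
  by (simp add: quant_error_def)

text \<open>In range, both points are cut after \<open>K\<close> coordinates. The tails are small by
  \<open>norm_l2_tail_le\<close>; the heads differ by at most the mesh \<open>A * h\<close> in each
  coordinate, in total by \<open>sqrt K * (A * h) = A * K powr (- b)\<close>. Out of range, the
  triangle inequality through the origin suffices.\<close>

lemma norm_diff_same_label:
  assumes M: "0 < M" and K: "0 < K" and b: "0 < b" and eq: "label b M K J x = label b M K J y"
  shows "norm (x - y) \<le> quant_error b M K J x + quant_error b M K J y"
proof (cases "in_range b M J x")
  case False
  then have "\<not> in_range b M J y" using eq by (auto simp: label_def split: if_splits)
  then show ?thesis using False M norm_triangle_ineq4[of x y]
    by (auto simp: quant_error_def intro: order.trans add_increasing add_increasing2)
next
  case True
  then have iny: "in_range b M J y" and lev: "level b M x = level b M y" and code: "code b M K x = code b M K y"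
    using eq by (auto simp: label_def split: if_splits)
  have wx: "poly_weight b x < \<top>" and wy: "poly_weight b y < \<top>"
    using True iny by (auto simp: in_range_def)
  define A where "A = M * real (level b M x)"
  have A: "0 < A" using M level_pos[of b M x] by (simp add: A_def)
  define h where "h = real K powr (- b - 1 / 2)"
  have h: "0 < h" using K by (simp add: h_def)
  let ?P = "\<lambda>x. l2_of_fun K (coord x)"
  have tail: "norm (x - ?P x) \<le> real K powr (- b) * poly_norm b x" if "poly_weight b x < \<top>" for x
  proof -
    have "norm (x - ?P x) \<le> real (Suc K) powr (- b) * poly_norm b x" by (rule norm_l2_tail_le[OF that b])
    also have "\<dots> \<le> real K powr (- b) * poly_norm b x"
      using K b by (intro mult_right_mono powr_mono2') auto
    finally show ?thesis .
  qed
  have "(norm (?P x - ?P y))\<^sup>2 = (\<Sum>m<K. (coord x m - coord y m)\<^sup>2)"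
  proof -
    have "?P x - ?P y = l2_of_fun K (\<lambda>m. coord x m - coord y m)" by (intro l2_eqI) simp
    then show ?thesis by (simp add: norm_l2_of_fun)
  qed
  also have "\<dots> \<le> (\<Sum>m<K. (A * h)\<^sup>2)"
  proof (rule sum_mono)
    fix m assume m: "m \<in> {..<K}"
    have "\<lfloor>coord x m / (A * h)\<rfloor> = \<lfloor>coord y m / (A * h)\<rfloor>"
      using fun_cong[OF code, of m] m lev by (simp add: code_def A_def h_def)
    then have "\<bar>coord x m / (A * h) - coord y m / (A * h)\<bar> \<le> 1" by linarith
    then have "\<bar>coord x m - coord y m\<bar> \<le> A * h"
      using A h by (simp add: diff_divide_distrib[symmetric] abs_mult)
    then show "(coord x m - coord y m)\<^sup>2 \<le> (A * h)\<^sup>2"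
      using A h by (intro abs_le_square_iff[THEN iffD1]) simp
  qed
  also have "\<dots> = (A * real K powr (- b))\<^sup>2"
  proof -
    have "sqrt (real K) * h = real K powr (- b)"
      using K by (simp add: h_def powr_half_sqrt[symmetric] powr_add[symmetric])
    then have "(sqrt (real K))\<^sup>2 * h\<^sup>2 = (real K powr (- b))\<^sup>2" by (simp only: power_mult_distrib[symmetric])
    then have "real K * h\<^sup>2 = (real K powr (- b))\<^sup>2" by simp
    then show ?thesis by (simp only: power_mult_distrib sum_constant card_lessThan) simp
  qed
  finally have "norm (?P x - ?P y) \<le> A * real K powr (- b)"
    by (rule power2_le_imp_le) (use A in simp)
  also have "\<dots> \<le> (M + poly_norm b x) * real K powr (- b)"
    using level_bounds(2)[OF M] by (intro mult_right_mono) (auto simp: A_def)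
  finally have "norm (?P x - ?P y) \<le> (M + poly_norm b x) * real K powr (- b)" .
  moreover have "norm (x - y) \<le> norm (x - ?P x) + norm (?P x - ?P y) + norm (y - ?P y)"
    using norm_triangle_ineq4[of "(x - ?P x) + (?P x - ?P y)" "y - ?P y"]
      norm_triangle_ineq[of "x - ?P x" "?P x - ?P y"] by (simp add: algebra_simps)
  ultimately have "norm (x - y) \<le> real K powr (- b) * poly_norm b x + (M + poly_norm b x) * real K powr (- b) + real K powr (- b) * poly_norm b y"
    using tail[OF wx] tail[OF wy] by linarith
  also have "\<dots> = real K powr (- b) * (M + 2 * poly_norm b x + poly_norm b y)"
    by (simp add: algebra_simps)
  also have "\<dots> \<le> real K powr (- b) * (2 * (M + poly_norm b x) + 2 * (M + poly_norm b y))"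
    using M by (intro mult_left_mono) auto
  also have "\<dots> = quant_error b M K J x + quant_error b M K J y"
    using True iny by (simp add: quant_error_def algebra_simps)
  finally show ?thesis .
qed

text \<open>A point in range has norm at most \<open>M * J\<close>, and any other point has its norm
  included in \<open>quant_error\<close>.\<close>

lemma norm_diff_le_quant_error:
  assumes M: "0 < M" and b: "0 < b"
  shows "norm (x - y) \<le> quant_error b M K J x + quant_error b M K J y + 2 * M * real J"
proof -
  have "norm x \<le> quant_error b M K J x + M * real J" for x
  proof (cases "in_range b M J x")
    case True
    then have "norm x \<le> M * real J"
      using norm_le_poly_norm[OF _ b, of x] by (auto simp: in_range_def)
    then show ?thesis using quant_error_nonneg[OF M] by (intro add_increasing)
  qed (use M in \<open>simp add: quant_error_def\<close>)
  from this[of x] this[of y] show ?thesis using norm_triangle_ineq4[of x y] by linarith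
qed

section \<open>The upper bound\<close>

text \<open>Applied to \<open>x = n\<close>: the logarithmic factors from the number of levels, the
  outer radius and the target rate are absorbed by a negative power of \<open>n\<close>.\<close>

lemma ln_powr_le_powr:
  assumes "0 < s" "0 < r" "0 < t"
  obtains C where "0 < C"
    "\<And>x :: real. 1 < x \<Longrightarrow> (ln x powr s + 1) powr r * ln x powr t * x powr (- 3 / 8) \<le> C"
proof
  define d where "d = s * r + t"
  \<comment> \<open>Spreads the exponent 3/8 evenly over the total power \<open>d\<close> of the
    logarithm, each power being bounded through \<open>ln x \<le> x powr a / a\<close>.\<close>
  define a where "a = 3 / (8 * d)"
  have d: "0 < d" using assms by (simp add: d_def add_pos_pos)
  have "a * s * r + a * t = a * d" by (simp add: d_def distrib_left)
  then have a: "0 < a" "a * s * r + a * t = 3 / 8"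
    using d by (simp_all add: a_def)
  define C where "C = (a powr (- s) + 1) powr r * a powr (- t)"
  have "0 < a powr (- s) + 1" by (intro add_nonneg_pos) auto
  then show "0 < C" using a by (auto simp: C_def intro!: mult_pos_pos)
  fix x :: real assume x: "1 < x"
  have lnp: "ln x powr c \<le> a powr (- c) * x powr (a * c)" if "0 < c" for c
  proof -
    have "ln x powr c \<le> (x powr a / a) powr c"
      using ln_powr_bound[of x a] a x that by (intro powr_mono2) auto
    also have "\<dots> = a powr (- c) * x powr (a * c)"
      using a x by (simp add: powr_divide powr_powr powr_minus field_simps)
    finally show ?thesis .
  qed
  have "ln x powr s + 1 \<le> a powr (- s) * x powr (a * s) + x powr (a * s)"
    using lnp[OF assms(1)] x a assms by (intro add_mono) (auto simp: ge_one_powr_ge_zero)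
  then have "(ln x powr s + 1) powr r \<le> ((a powr (- s) + 1) * x powr (a * s)) powr r"
    using assms by (intro powr_mono2) (auto simp: algebra_simps)
  also have "\<dots> = (a powr (- s) + 1) powr r * x powr (a * s * r)"
    by (simp add: powr_mult powr_powr)
  finally have "(ln x powr s + 1) powr r * ln x powr t * x powr (- 3 / 8) \<le>
    (a powr (- s) + 1) powr r * x powr (a * s * r) * (a powr (- t) * x powr (a * t)) * x powr (- 3 / 8)"
    using lnp[OF assms(3)] by (intro mult_right_mono mult_mono) auto
  also have "\<dots> = C * (x powr (a * s * r) * x powr (a * t) * x powr (- 3 / 8))"
    by (simp add: C_def)
  also have "x powr (a * s * r) * x powr (a * t) * x powr (- 3 / 8) = x powr (a * s * r + a * t + - 3 / 8)"
    by (simp only: powr_add)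
  also have "\<dots> = 1" using a x by simp
  finally show "(ln x powr s + 1) powr r * ln x powr t * x powr (- 3 / 8) \<le> C" by simp
qed

lemma ennreal_powr_poly_weight:
  assumes "poly_weight b x < \<top>"
  shows "ennreal_powr (poly_weight b x) (q / 2) = ennreal (poly_norm b x powr q)"
proof -
  obtain r where r: "poly_weight b x = ennreal r" "0 \<le> r"
    using assms by (cases "poly_weight b x") auto
  then show ?thesis
    by (simp add: poly_norm_def ennreal_powr_ennreal powr_half_sqrt[symmetric] powr_powr)
qed

lemma P_polyD:
  assumes "\<mu> \<in> P_poly q b M" "0 < q"
  shows "AE x in \<mu>. poly_weight b x < \<top>"
    "(\<integral>\<^sup>+ x. ennreal (poly_norm b x powr q) \<partial>\<mu>) \<le> ennreal (M powr q)"
proof -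
  have sM [measurable_cong, simp]: "sets \<mu> = sets borel"
    using assms(1) by (auto simp: P_poly_def l2_prob_def)
  have int: "(\<integral>\<^sup>+ x. ennreal_powr (poly_weight b x) (q / 2) \<partial>\<mu>) \<le> ennreal (M powr q)"
    using assms(1) by (simp add: P_poly_def poly_weight_def)
  have meas [measurable]: "(\<lambda>x. ennreal_powr (poly_weight b x) (q / 2)) \<in> borel_measurable \<mu>"
    unfolding ennreal_powr_def by measurable
  have "AE x in \<mu>. ennreal_powr (poly_weight b x) (q / 2) \<noteq> \<infinity>"
    using int by (intro nn_integral_PInf_AE meas) (auto simp: top_unique)
  then show AE: "AE x in \<mu>. poly_weight b x < \<top>"
    by (rule eventually_mono) (auto simp: ennreal_powr_def less_top split: if_splits)
  have "(\<integral>\<^sup>+ x. ennreal (poly_norm b x powr q) \<partial>\<mu>) = (\<integral>\<^sup>+ x. ennreal_powr (poly_weight b x) (q / 2) \<partial>\<mu>)"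
    using AE by (intro nn_integral_cong_AE) (auto elim!: eventually_mono simp: ennreal_powr_poly_weight)
  then show "(\<integral>\<^sup>+ x. ennreal (poly_norm b x powr q) \<partial>\<mu>) \<le> ennreal (M powr q)" using int by simp
qed

text \<open>Lets the moment of order \<open>q\<close> control that of order \<open>p\<close>: above
  the threshold \<open>M\<close>, the factor \<open>g powr (p - q)\<close> is at most
  \<open>M powr (p - q)\<close>.\<close>

lemma powr_le_split:
  fixes g M p q :: real
  assumes "0 \<le> g" "0 < M" "0 \<le> p" "p \<le> q"
  shows "g powr p \<le> M powr p + M powr (p - q) * g powr q"
proof (cases "g \<le> M")
  case True
  then have "g powr p \<le> M powr p" using assms by (intro powr_mono2) auto
  then show ?thesis by (simp add: add_increasing2)
next
  case False
  then have "g powr (p - q) \<le> M powr (p - q)" using assms by (intro powr_mono2') auto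
  then have "g powr (p - q) * g powr q \<le> M powr (p - q) * g powr q" by (intro mult_right_mono) auto
  then show ?thesis using False assms by (simp add: powr_add[symmetric] add_increasing)
qed

text \<open>The cell error is \<open>K powr (- b)\<close> times a quantity with \<open>p\<close>-th
  moment of order \<open>M powr p\<close>. Out of range the weighted norm is almost surely at least
  \<open>M * J\<close>, so the surplus \<open>q - p\<close> of moments gains the factor
  \<open>J powr (p - q)\<close>.\<close>

lemma nn_integral_quant_error_le:
  assumes p: "1 \<le> p" "p < q" and b: "0 < b" and M: "0 < M" and J: "0 < J" and K: "0 < K"
    and \<mu>: "\<mu> \<in> P_poly q b M"
  shows "(\<integral>\<^sup>+ x. ennreal (quant_error b M K J x powr p) \<partial>\<mu>) \<le>
    ennreal (3 * 18 powr p * M powr p * (real K powr (- (b * p)) + real J powr (p - q)))"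
proof -
  interpret prob_space \<mu> using \<mu> by (simp add: P_poly_def l2_prob_def)
  have sM [measurable_cong, simp]: "sets \<mu> = sets borel"
    using \<mu> by (auto simp: P_poly_def l2_prob_def)
  define k where "k = real K powr (- (b * p))"
  define j where "j = real J powr (p - q)"
  have k0: "0 \<le> k" and j0: "0 \<le> j" by (auto simp: k_def j_def)
  \<comment> \<open>Coefficients of a pointwise bound affine in \<open>poly_norm b x powr q\<close>,
    to be integrated with the moment condition.\<close>
  define \<alpha> where "\<alpha> = 3 powr p * (6 powr p * k * (2 * M powr p))"
  define \<beta> where "\<beta> = 3 powr p * (6 powr p * k * M powr (p - q) + M powr (p - q) * j)"
  have \<alpha>\<beta>: "0 \<le> \<alpha>" "0 \<le> \<beta>" using k0 j0 by (auto simp: \<alpha>_def \<beta>_def)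
  have pw: "quant_error b M K J x powr p \<le> \<alpha> + \<beta> * poly_norm b x powr q" if w: "poly_weight b x < \<top>" for x
  proof -
    let ?g = "poly_norm b x"
    let ?o = "if in_range b M J x then 0 else norm x"
    \<comment> \<open>The summand 0 fits a sum of two terms to \<open>powr_add3_le\<close>.\<close>
    have "quant_error b M K J x powr p = (2 * real K powr (- b) * (M + ?g) + ?o + 0) powr p"
      by (simp add: quant_error_def)
    also have "\<dots> \<le> 3 powr p * ((2 * real K powr (- b) * (M + ?g)) powr p + ?o powr p + 0 powr p)"
      using M p by (intro powr_add3_le) auto
    also have "\<dots> \<le> 3 powr p * (6 powr p * k * (2 * M powr p + M powr (p - q) * ?g powr q) + M powr (p - q) * j * ?g powr q)"
    proof (rule mult_left_mono)
      have "(2 * real K powr (- b) * (M + ?g)) powr p = 2 powr p * k * (M + ?g + 0) powr p"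
        using M by (simp add: powr_mult powr_powr k_def)
      also have "\<dots> \<le> 2 powr p * k * (3 powr p * (M powr p + ?g powr p + 0 powr p))"
        using M p k0 by (intro mult_left_mono powr_add3_le) auto
      also have "\<dots> \<le> 2 powr p * k * (3 powr p * (2 * M powr p + M powr (p - q) * ?g powr q))"
        using powr_le_split[of ?g M p q] M p k0 by (intro mult_left_mono) auto
      also have "\<dots> = 6 powr p * k * (2 * M powr p + M powr (p - q) * ?g powr q)"
        using powr_mult[of 2 3 p] by simp
      finally have 1: "(2 * real K powr (- b) * (M + ?g)) powr p \<le> 6 powr p * k * (2 * M powr p + M powr (p - q) * ?g powr q)" .
      have 2: "?o powr p \<le> M powr (p - q) * j * ?g powr q"
      proof (cases "in_range b M J x")
        case False
        then have g: "M * real J \<le> ?g" using w by (simp add: in_range_def)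
        have MJ: "0 < M * real J" using M J by simp
        have "norm x powr p \<le> ?g powr p"
          using norm_le_poly_norm[OF w b] p by (intro powr_mono2) auto
        also have "\<dots> = ?g powr (p - q) * ?g powr q" using g MJ by (simp add: powr_add[symmetric])
        also have "\<dots> \<le> (M * real J) powr (p - q) * ?g powr q"
          using g MJ p by (intro mult_right_mono powr_mono2') auto
        also have "\<dots> = M powr (p - q) * j * ?g powr q" using M by (simp add: powr_mult j_def)
        finally show ?thesis using False by simp
      qed (use j0 p in simp)
      show "(2 * real K powr (- b) * (M + ?g)) powr p + ?o powr p + 0 powr p \<le>
        6 powr p * k * (2 * M powr p + M powr (p - q) * ?g powr q) + M powr (p - q) * j * ?g powr q"
        using 1 2 by simp
    qed simp
    also have "\<dots> = \<alpha> + \<beta> * ?g powr q" by (simp add: \<alpha>_def \<beta>_def algebra_simps)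
    finally show ?thesis .
  qed
  have "(\<integral>\<^sup>+ x. ennreal (quant_error b M K J x powr p) \<partial>\<mu>) \<le>
      (\<integral>\<^sup>+ x. ennreal \<alpha> + ennreal \<beta> * ennreal (poly_norm b x powr q) \<partial>\<mu>)"
  proof (rule nn_integral_mono_AE)
    have "AE x in \<mu>. poly_weight b x < \<top>" using P_polyD(1)[OF \<mu>] p by simp
    then show "AE x in \<mu>. ennreal (quant_error b M K J x powr p) \<le> ennreal \<alpha> + ennreal \<beta> * ennreal (poly_norm b x powr q)"
      by (rule eventually_mono) (use \<alpha>\<beta> pw in \<open>simp add: ennreal_mult[symmetric] ennreal_plus[symmetric] ennreal_leI del: ennreal_plus\<close>)
  qed
  also have "\<dots> = ennreal \<alpha> + ennreal \<beta> * (\<integral>\<^sup>+ x. ennreal (poly_norm b x powr q) \<partial>\<mu>)"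
    by (subst nn_integral_add, measurable, subst nn_integral_cmult, measurable) (simp add: emeasure_space_1)
  also have "\<dots> \<le> ennreal \<alpha> + ennreal \<beta> * ennreal (M powr q)"
    using P_polyD(2)[OF \<mu>] p by (intro add_left_mono mult_left_mono) auto
  also have "\<dots> = ennreal (\<alpha> + \<beta> * M powr q)"
    using \<alpha>\<beta> by (simp add: ennreal_mult[symmetric] ennreal_plus[symmetric] del: ennreal_plus)
  also have "\<dots> \<le> ennreal (3 * 18 powr p * M powr p * (k + j))"
  proof (rule ennreal_leI)
    have MM: "M powr (p - q) * M powr q = M powr p" using M by (simp add: powr_add[symmetric])
    have 18: "3 powr p * 6 powr p = (18 :: real) powr p" using powr_mult[of 3 6 p] by simp
    have "\<alpha> + \<beta> * M powr q = 3 powr p * (6 powr p * k * (2 * M powr p)) +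
        3 powr p * (6 powr p * k * (M powr (p - q) * M powr q) + (M powr (p - q) * M powr q) * j)"
      by (simp add: \<alpha>_def \<beta>_def algebra_simps)
    also have "\<dots> = 3 * (3 powr p * 6 powr p) * M powr p * k + 3 powr p * M powr p * j"
      unfolding MM by (simp add: algebra_simps)
    also have "\<dots> \<le> 3 * 18 powr p * M powr p * k + 3 * 18 powr p * M powr p * j"
    proof (intro add_mono mult_right_mono)
      have "(3 :: real) powr p \<le> 18 powr p" using p by (intro powr_mono2) auto
      then show "(3 :: real) powr p \<le> 3 * 18 powr p" using powr_ge_zero[of 18 p] by linarith
    qed (use 18 k0 j0 in auto)
    finally show "\<alpha> + \<beta> * M powr q \<le> 3 * 18 powr p * M powr p * (k + j)" by (simp add: algebra_simps)
  qed
  finally show ?thesis by (simp add: k_def j_def)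
qed

lemma SUP_expected_wasserstein_le:
  fixes p q b :: real
  assumes p: "1 \<le> p" "p < q" and b: "0 < b"
  obtains C where "0 < C" "\<And>M n. 0 < M \<Longrightarrow> 2 \<le> n \<Longrightarrow>
    (SUP \<mu>\<in>P_poly q b M. expected_wasserstein p n \<mu>) \<le> ennreal (C * M * ln (real n) powr (- b))"
proof -
  \<comment> \<open>With \<open>J\<close> about \<open>L powr s\<close>, the out-of-range term
    \<open>J powr (p - q)\<close> is at most \<open>L powr (- (b * p))\<close>, the target rate to
    the power \<open>p\<close>.\<close>
  define s where "s = b * p / (q - p)"
  have s: "0 < s" "s * (p - q) = - (b * p)" using p b by (auto simp: s_def field_simps)
  \<comment> \<open>In the exponent \<open>p + 1\<close>, the \<open>p\<close> comes from the outer
    radius in \<open>D powr p\<close> and the 1 from the number of levels.\<close>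
  obtain C1 where C1: "0 < C1"
    "\<And>x :: real. 1 < x \<Longrightarrow> (ln x powr s + 1) powr (p + 1) * ln x powr (b * p) * x powr (- 3 / 8) \<le> C1"
    using ln_powr_le_powr[of s "p + 1" "b * p"] s p b by auto
  \<comment> \<open>With \<open>K\<close> about \<open>\<epsilon> * L\<close>, each level has at
    most a constant times \<open>n powr (1 / 8)\<close> codes; against \<open>1 / sqrt n\<close>
    this leaves \<open>n powr (- 3 / 8)\<close>.\<close>
  define \<epsilon> where "\<epsilon> = 1 / (8 * (4 + b))"
  have \<epsilon>: "0 < \<epsilon>" "(4 + b) * \<epsilon> = 1 / 8" using b by (auto simp: \<epsilon>_def field_simps)
  define C2 where "C2 = 6 * 18 powr p * (\<epsilon> powr (- (b * p)) + 1) + 2 * 2 powr p * exp (4 + b) * C1"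
  have C2: "0 < C2" using C1 by (auto simp: C2_def intro!: add_pos_pos add_nonneg_pos mult_pos_pos)
  show ?thesis
  proof (rule that[of "6 * C2 powr (1 / p)"])
    show "0 < 6 * C2 powr (1 / p)" using C2 by simp
    fix M :: real and n :: nat assume M: "0 < M" and n: "2 \<le> n"
    define L where "L = ln (real n)"
    have L: "0 < L" using n by (simp add: L_def)
    define K where "K = nat \<lceil>\<epsilon> * L\<rceil>"
    define J where "J = nat \<lceil>L powr s\<rceil>"
    have \<epsilon>L: "0 < \<epsilon> * L" using \<epsilon> L by simp
    have K: "0 < K" "\<epsilon> * L \<le> real K" "real K \<le> \<epsilon> * L + 1"
      using \<epsilon>L unfolding K_def by linarith+
    have Ls: "0 < L powr s" using L by simp
    have J: "0 < J" "L powr s \<le> real J" "real J \<le> L powr s + 1"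
      using Ls unfolding J_def by linarith+
    have Kp: "real K powr (- (b * p)) \<le> \<epsilon> powr (- (b * p)) * L powr (- (b * p))"
    proof -
      have "real K powr (- (b * p)) \<le> (\<epsilon> * L) powr (- (b * p))"
        using K \<epsilon>L b p by (intro powr_mono2') auto
      then show ?thesis using \<epsilon> L by (simp add: powr_mult)
    qed
    have Jp: "real J powr (p - q) \<le> L powr (- (b * p))"
    proof -
      have "real J powr (p - q) \<le> (L powr s) powr (p - q)"
        using J Ls p by (intro powr_mono2') auto
      then show ?thesis by (simp add: powr_powr s)
    qed
    define A where "A = 3 * 18 powr p * M powr p * (real K powr (- (b * p)) + real J powr (p - q))"
    have A0: "0 \<le> A" by (simp add: A_def)
    have A: "2 * A \<le> 6 * 18 powr p * (\<epsilon> powr (- (b * p)) + 1) * (M powr p * L powr (- (b * p)))"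
    proof -
      have "A \<le> 3 * 18 powr p * M powr p * (\<epsilon> powr (- (b * p)) * L powr (- (b * p)) + L powr (- (b * p)))"
        unfolding A_def using Kp Jp by (intro mult_left_mono add_mono) auto
      then show ?thesis by (simp add: algebra_simps)
    qed
    define D where "D = 2 * M * real J"
    have card: "real (card (labels b K J)) \<le> 2 * real J * exp (4 + b) * real n powr (1 / 8)"
    proof -
      have "(4 + b) * real K \<le> (4 + b) * (\<epsilon> * L + 1)"
        using K b by (intro mult_left_mono) auto
      also have "\<dots> = ((4 + b) * \<epsilon>) * L + (4 + b)" by (simp add: algebra_simps)
      finally have "exp ((4 + b) * real K) \<le> exp (1 / 8 * L + (4 + b))" unfolding \<epsilon> by simp
      also have "\<dots> = exp (4 + b) * real n powr (1 / 8)"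
        using n by (simp add: exp_add powr_def L_def)
      finally have e: "exp ((4 + b) * real K) \<le> exp (4 + b) * real n powr (1 / 8)" .
      \<comment> \<open>Allows the single label \<open>None\<close> to be absorbed in a factor
        2.\<close>
      have "1 * 1 \<le> real J * exp ((4 + b) * real K)"
        using J b by (intro mult_mono) auto
      then have "real (card (labels b K J)) \<le> 2 * real J * exp ((4 + b) * real K)"
        using finite_labels(2)[OF K(1) b, of J] by linarith
      also have "\<dots> \<le> 2 * real J * (exp (4 + b) * real n powr (1 / 8))"
        using e by (intro mult_left_mono) auto
      finally show ?thesis by (simp add: mult_ac)
    qed
    have dev: "D powr p * (real (card (labels b K J)) / sqrt (real n)) \<le>
        2 * 2 powr p * exp (4 + b) * C1 * (M powr p * L powr (- (b * p)))"
    proof -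
      have "D powr p * (real (card (labels b K J)) / sqrt (real n)) \<le>
          D powr p * (2 * real J * exp (4 + b) * real n powr (1 / 8) / sqrt (real n))"
        using card by (intro mult_left_mono divide_right_mono) auto
      also have "real n powr (1 / 8) / sqrt (real n) = real n powr (- 3 / 8)"
        using n by (simp add: powr_half_sqrt[symmetric] powr_diff[symmetric])
      then have "D powr p * (2 * real J * exp (4 + b) * real n powr (1 / 8) / sqrt (real n)) =
          D powr p * (2 * real J * exp (4 + b) * real n powr (- 3 / 8))"
        by (simp only: times_divide_eq_right[symmetric])
      also have "\<dots> = 2 * 2 powr p * exp (4 + b) * M powr p * (real J powr (p + 1) * real n powr (- 3 / 8))"
        using M J by (simp add: D_def powr_mult powr_add)
      also have "\<dots> \<le> 2 * 2 powr p * exp (4 + b) * M powr p * (C1 * L powr (- (b * p)))"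
      proof (rule mult_left_mono)
        have "real J powr (p + 1) * L powr (b * p) * real n powr (- 3 / 8) \<le> C1"
        proof -
          have "real J powr (p + 1) * L powr (b * p) * real n powr (- 3 / 8) \<le>
              (L powr s + 1) powr (p + 1) * L powr (b * p) * real n powr (- 3 / 8)"
            using J p by (intro mult_right_mono powr_mono2) auto
          also have "\<dots> \<le> C1" using C1(2)[of "real n"] n by (simp add: L_def)
          finally show ?thesis .
        qed
        then show "real J powr (p + 1) * real n powr (- 3 / 8) \<le> C1 * L powr (- (b * p))"
          using L by (simp add: powr_minus field_simps)
      qed simp
      finally show ?thesis by (simp add: mult_ac)
    qed
    \<comment> \<open>A constant times the \<open>p\<close>-th power of the target rate; the two
      summands of \<open>C2\<close> belong to the quantization error and to the cell
      fluctuations.\<close>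
    define B where "B = C2 * (M powr p * L powr (- (b * p)))"
    have B0: "0 < B" using C2 M L by (simp add: B_def)
    have B: "2 * A + D powr p * (real (card (labels b K J)) / sqrt (real n)) \<le> B"
      using add_mono[OF A dev]
      by (simp only: B_def C2_def distrib_right[of _ _ "M powr p * L powr (- (b * p))"])
    have Bp: "B powr (1 / p) = C2 powr (1 / p) * (M * L powr (- b))"
      using C2 M L p by (simp add: B_def powr_mult powr_powr)
    show "(SUP \<mu>\<in>P_poly q b M. expected_wasserstein p n \<mu>) \<le>
        ennreal (6 * C2 powr (1 / p) * M * ln (real n) powr (- b))"
    proof (rule SUP_least)
      fix \<mu> assume \<mu>: "\<mu> \<in> P_poly q b M"
      then have \<mu>': "\<mu> \<in> l2_prob" by (simp add: P_poly_def)
      have "expected_wasserstein p n \<mu> \<le> ennreal (6 * B powr (1 / p))"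
      proof (rule expected_wasserstein_le_partition[where A = A and D = D, OF p(1) \<mu>'])
        show "finite (labels b K J)" using finite_labels(1)[OF K(1) b] .
        show "label b M K J x \<in> labels b K J" for x using label_in_labels[OF M K(1) b] .
        show "label b M K J -` {z} \<in> sets borel" if "z \<in> labels b K J" for z
          using label_vimage_sets[OF that] .
        show "norm (x - y) \<le> quant_error b M K J x + quant_error b M K J y"
          if "label b M K J x = label b M K J y" for x y
          using norm_diff_same_label[OF M K(1) b that] .
        show "norm (x - y) \<le> quant_error b M K J x + quant_error b M K J y + D" for x y
          unfolding D_def by (rule norm_diff_le_quant_error[OF M b])
        show "(\<integral>\<^sup>+ x. ennreal (quant_error b M K J x powr p) \<partial>\<mu>) \<le> ennreal A"
          unfolding A_def by (rule nn_integral_quant_error_le[OF p b M J(1) K(1) \<mu>])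
        show "0 < n" "0 \<le> D" using n M by (simp_all add: D_def)
        show "quant_error b M K J \<in> borel_measurable borel" by (rule measurable_quant_error)
      qed (fact A0 B B0 quant_error_nonneg[OF M])+
      then show "expected_wasserstein p n \<mu> \<le> ennreal (6 * C2 powr (1 / p) * M * ln (real n) powr (- b))"
        unfolding Bp L_def by (simp only: mult.assoc)
    qed
  qed
qed

theorem theorem4p1:
  fixes p q b :: real
  assumes "1 \<le> p" and "p < q" and "b > 1 / 2"
  shows "\<exists>c_low c_up :: real. 0 < c_low \<and> 0 < c_up \<and>
    (\<forall>M > 0. \<forall>n \<ge> 2.
      ennreal (c_low * M * ln (real n) powr (- b))
        \<le> (SUP \<mu>\<in>P_poly q b M. expected_wasserstein p n \<mu>) \<and>
      (SUP \<mu>\<in>P_poly q b M. expected_wasserstein p n \<mu>)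
        \<le> ennreal (c_up * M * ln (real n) powr (- b)))"
proof -
  have q: "0 < q" and b: "0 < b" using assms by auto
  obtain C where C: "0 < C" "\<And>M n. 0 < M \<Longrightarrow> 2 \<le> n \<Longrightarrow>
    (SUP \<mu>\<in>P_poly q b M. expected_wasserstein p n \<mu>) \<le> ennreal (C * M * ln (real n) powr (- b))"
    using SUP_expected_wasserstein_le[OF assms(1,2) b] by blast
  show ?thesis
    using C SUP_expected_wasserstein_ge[OF assms(1) q b]
    by (intro exI[of _ "18 powr (- b) / 8"] exI[of _ C]) simp
qed

end
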